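(* Let $X(t)$, $t=(\theta,\varphi)\in S_2$, be a zero-mean tensor-valued random field of rank $2$ on the unit sphere $S_2$, with components given with respect to the polar (spherical) coordinate system, and suppose that its tangential part forms a symmetric trace-free tensor, i.e. $X_{\varphi\varphi}+X_{\theta\theta}=0$ and $X_{\theta\varphi}=X_{\varphi\theta}$. Represent the tangential part by two complex random functions on the rotation group $SO(3)$: for $g=g(\varphi_1,\theta,\varphi_2)$ and $\varphi=\frac{\pi}{2}-\varphi_1$, $$A(g)=2\left(X_{\varphi\varphi}(\theta,\varphi)+iX_{\theta\varphi}(\theta,\varphi)\right)e^{2i\varphi_2},\qquad B(g)=2\left(X_{\varphi\varphi}(\theta,\varphi)-iX_{\theta\varphi}(\theta,\varphi)\right)e^{-2i\varphi_2}.$$ Suppose that $A(g)$ and $B(g)$ are weakly (second-order) isotropic and mean square continuous. Then there exist constants $A_l,B_l$ and random variables $Z^A_{lm},Z^B_{lm}$ ($l=0,1,2,\dots$, $m=-l,\dots,l$) with $$E\left(Z_{lm}^{A}\overline{Z_{l'm'}^{A}}\right)=\delta_{ll'}\delta_{mm'},\qquad E\left(Z_{lm}^{B}\overline{Z_{l'm'}^{B}}\right)=\delta_{ll'}\delta_{mm'},$$ such that $$A(g)=\sum_{l=0}^\infty\sum_{m=-l}^l A_l\,T^l_{2m}(g^{-1})\,Z^A_{lm},\qquad B(g)=\sum_{l=0}^\infty\sum_{m=-l}^l B_l\,T^l_{-2,m}(g^{-1})\,Z^B_{lm},$$ where the series converge in $L^2(P(d\omega))$ for every $g\in SO(3)$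 (pointwise in $g$). The corresponding covariance functions have the series representations $$E\left(A(g_1)\overline{A(g_2)}\right)=\sum_{l=0}^\infty|A_l|^2\,T^l_{22}(g_1^{-1}g_2),\qquad E\left(B(g_1)\overline{B(g_2)}\right)=\sum_{l=0}^\infty|B_l|^2\,T^l_{-2,-2}(g_1^{-1}g_2).$$
   Context: All random variables live on a probability space $(\Omega,\mathcal F,P)$; $L^2(P(d\omega))$ is the Hilbert space of complex random variables $Y$ with $E|Y|^2<\infty$ and inner product $(Y_1,Y_2)=E(Y_1\overline{Y_2})$. Euler angles: $g=g(\varphi_1,\theta,\varphi_2)\in SO(3)$ is the product of three successive rotations: by $\varphi_1$ around the $z$ axis, by $\theta$ around the new $x$ axis, and by $\varphi_2$ around the new $z$ axis. Generalized spherical functions: for each integer $l\ge 0$, $T^l(g)=\{T^l_{mn}(g)\}_{m,n=-l,\dots,l}$ denotes the matrix of the irreducible unitary representation of $SO(3)$ of weight $l$ (dimension $2l+1$) in the canonical basis, i.e. an orthonormal basis of eigenvectors of the rotations about the $z$ axis, the rotation by angle $\varphi$ having eigenvalue $e^{-in\varphi}$ on the $n$-th vector. Thus $T^l_{mn}(g(\varphi_1,\theta,\varphi_2))=e^{-im\varphi_1}P^l_{mn}(\cos\theta)e^{-in\varphi_2}$ and $T^l_{mn}(g_1g_2)=\sum_{s=-l}^l T^l_{ms}(g_1)T^l_{sn}(g_2)$. By convention $T^l_{mn}=0$ if $|m|>l$ or $|n|>l$. $X_{\varphi\varphi},X_{\varphi\theta},X_{\theta\varphi},X_{\theta\theta}$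 are the components of the tensor relative to the tangential unit vectors $e_\theta,e_\varphi$ of the spherical coordinate system. (The formulas for $A(g)$, $B(g)$ are for $0<\theta<\pi$; at the poles, where the spherical basis is undefined, the values of the random functions on $SO(3)$ are those determined by mean square continuity.) A random function $Y(g)$, $g\in SO(3)$, is weakly (second-order) isotropic if its covariance function $R(g_1,g_2)=E(Y(g_1)\overline{Y(g_2)})$ satisfies $R(gg_1,gg_2)=R(g_1,g_2)$ for all $g,g_1,g_2\in SO(3)$. It is mean square continuous if $g\mapsto Y(g)$ is continuous as a map into $L^2(P(d\omega))$.
   Formalization: The random variables Z_lm exist on the probability space enlarged by an independent uniform variable (an infinite orthonormal family need not exist on the given space, e.g. one point); those with A_l ≠ 0 (resp. B_l ≠ 0) are variables on the original space. *)

theory Defs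
  imports "HOL-Probability.Probability"
begin

section \<open>The rotation group and Euler angles\<close>

definition SO3 :: "(real^3^3) set" where
  "SO3 = {g. rotation_matrix g}"

definition rot_z :: "real \<Rightarrow> real^3^3" where
  "rot_z \<alpha> = vector [vector [cos \<alpha>, - sin \<alpha>, 0],
                     vector [sin \<alpha>,   cos \<alpha>, 0],
                     vector [0,       0,       1]]"

definition rot_x :: "real \<Rightarrow> real^3^3" where
  "rot_x \<alpha> = vector [vector [1, 0,       0      ],
                     vector [0, cos \<alpha>, - sin \<alpha>],
                     vector [0, sin \<alpha>,   cos \<alpha>]]"

text \<open>Successive rotations about the moved axes multiply from left to right. The last two
  rotations are about the axes carried along by the preceding ones.\<close>

definition euler :: "real \<Rightarrow> real \<Rightarrow> real \<Rightarrow> real^3^3" where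
  "euler \<phi>1 \<theta> \<phi>2 = rot_z \<phi>1 ** rot_x \<theta> ** rot_z \<phi>2"

lemma rot_z_SO3: "rot_z \<alpha> \<in> SO3"
proof -
  have "cos \<alpha> * cos \<alpha> + sin \<alpha> * sin \<alpha> = 1" "sin \<alpha> * sin \<alpha> + cos \<alpha> * cos \<alpha> = 1"
    by (simp_all flip: power2_eq_square)
  then show ?thesis
    by (simp add: SO3_def rotation_matrix_def orthogonal_matrix rot_z_def vec_eq_iff
        forall_3 matrix_matrix_mult_def transpose_def mat_def sum_3 det_3 mult.commute)
qed

lemma rot_x_SO3: "rot_x \<alpha> \<in> SO3"
proof -
  have "cos \<alpha> * cos \<alpha> + sin \<alpha> * sin \<alpha> = 1" "sin \<alpha> * sin \<alpha> + cos \<alpha> * cos \<alpha> = 1"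
    by (simp_all flip: power2_eq_square)
  then show ?thesis
    by (simp add: SO3_def rotation_matrix_def orthogonal_matrix rot_x_def vec_eq_iff
        forall_3 matrix_matrix_mult_def transpose_def mat_def sum_3 det_3 mult.commute)
qed

lemma euler_SO3: "euler \<phi>1 \<theta> \<phi>2 \<in> SO3"
  using rot_z_SO3 rot_x_SO3
  by (simp add: SO3_def rotation_matrix_def euler_def orthogonal_matrix_mul det_mul)


section \<open>Generalized spherical functions\<close>

text \<open>A matrix of size \<open>2l+1\<close> with rows and columns labelled by \<open>-l, \<dots>, l\<close> is a function on
  \<open>int \<times> int\<close> that vanishes outside these labels; likewise for vectors.\<close>

definition degs :: "nat \<Rightarrow> int set" where
  "degs l = {- int l .. int l}"

definition rep_irreducible :: "nat \<Rightarrow> (real^3^3 \<Rightarrow> int \<Rightarrow> int \<Rightarrow> complex) \<Rightarrow> bool" where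
  "rep_irreducible l D \<longleftrightarrow>
     (\<forall>W \<subseteq> {v. \<forall>n. n \<notin> degs l \<longrightarrow> v n = 0}.
        (\<lambda>_. 0) \<in> W \<and>
        (\<forall>v\<in>W. \<forall>w\<in>W. (\<lambda>n. v n + w n) \<in> W) \<and>
        (\<forall>c. \<forall>v\<in>W. (\<lambda>n. c * v n) \<in> W) \<and>
        (\<forall>g\<in>SO3. \<forall>v\<in>W. (\<lambda>m. \<Sum>n\<in>degs l. D g m n * v n) \<in> W)
        \<longrightarrow> W = {\<lambda>_. 0} \<or> W = {v. \<forall>n. n \<notin> degs l \<longrightarrow> v n = 0})"

text \<open>\<open>canonical_rep l D\<close>: \<open>D\<close> is the matrix, in a canonical basis, of the (continuous)
  irreducible unitary representation of weight \<open>l\<close>. The canonical basis, and hence \<open>D\<close>, is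
  determined up to a phase factor for each basis vector; the irreducible representation of
  dimension \<open>2l+1\<close> itself is determined up to unitary equivalence.\<close>

definition canonical_rep :: "nat \<Rightarrow> (real^3^3 \<Rightarrow> int \<Rightarrow> int \<Rightarrow> complex) \<Rightarrow> bool" where
  "canonical_rep l D \<longleftrightarrow>
     (\<forall>g m n. m \<notin> degs l \<or> n \<notin> degs l \<longrightarrow> D g m n = 0) \<and>
     (\<forall>g1\<in>SO3. \<forall>g2\<in>SO3. \<forall>m n. D (g1 ** g2) m n = (\<Sum>s\<in>degs l. D g1 m s * D g2 s n)) \<and>
     (\<forall>g\<in>SO3. \<forall>m\<in>degs l. \<forall>n\<in>degs l.
        (\<Sum>s\<in>degs l. D g m s * cnj (D g n s)) = of_bool (m = n)) \<and>
     (\<forall>m n. continuous_on SO3 (\<lambda>g. D g m n)) \<and>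
     rep_irreducible l D \<and>
     (\<forall>\<alpha>. \<forall>m\<in>degs l. \<forall>n\<in>degs l.
        D (rot_z \<alpha>) m n = (if m = n then cis (- (of_int n * \<alpha>)) else 0))"


section \<open>Complex random variables of second order\<close>

definition L2_space :: "'w measure \<Rightarrow> ('w \<Rightarrow> complex) set" where
  "L2_space M = {Y \<in> borel_measurable M. integrable M (\<lambda>\<omega>. (cmod (Y \<omega>))\<^sup>2)}"

definition L2_inner :: "'w measure \<Rightarrow> ('w \<Rightarrow> complex) \<Rightarrow> ('w \<Rightarrow> complex) \<Rightarrow> complex" where
  "L2_inner M Y1 Y2 = (\<integral>\<omega>. Y1 \<omega> * cnj (Y2 \<omega>) \<partial>M)"

definition L2_sq_dist :: "'w measure \<Rightarrow> ('w \<Rightarrow> complex) \<Rightarrow> ('w \<Rightarrow> complex) \<Rightarrow> real" where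
  "L2_sq_dist M Y1 Y2 = (\<integral>\<omega>. (cmod (Y1 \<omega> - Y2 \<omega>))\<^sup>2 \<partial>M)"

definition L2_sums :: "'w measure \<Rightarrow> (nat \<Rightarrow> 'w \<Rightarrow> complex) \<Rightarrow> ('w \<Rightarrow> complex) \<Rightarrow> bool" where
  "L2_sums M f Y \<longleftrightarrow>
     (\<forall>l. f l \<in> L2_space M) \<and> Y \<in> L2_space M \<and>
     (\<lambda>L. L2_sq_dist M (\<lambda>\<omega>. \<Sum>l<L. f l \<omega>) Y) \<longlonglongrightarrow> 0"

definition L2_orthonormal :: "'w measure \<Rightarrow> (nat \<Rightarrow> int \<Rightarrow> 'w \<Rightarrow> complex) \<Rightarrow> bool" where
  "L2_orthonormal M Z \<longleftrightarrow>
     (\<forall>l. \<forall>m\<in>degs l. Z l m \<in> L2_space M) \<and>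
     (\<forall>l l'. \<forall>m\<in>degs l. \<forall>m'\<in>degs l'.
        L2_inner M (Z l m) (Z l' m') = of_bool (l = l') * of_bool (m = m'))"

definition ms_continuous :: "'w measure \<Rightarrow> (real^3^3 \<Rightarrow> 'w \<Rightarrow> complex) \<Rightarrow> bool" where
  "ms_continuous M Y \<longleftrightarrow>
     (\<forall>g\<in>SO3. Y g \<in> L2_space M) \<and>
     (\<forall>g\<in>SO3. ((\<lambda>h. L2_sq_dist M (Y h) (Y g)) \<longlongrightarrow> 0) (at g within SO3))"

definition weakly_isotropic :: "'w measure \<Rightarrow> (real^3^3 \<Rightarrow> 'w \<Rightarrow> complex) \<Rightarrow> bool" where
  "weakly_isotropic M Y \<longleftrightarrow>
     (\<forall>g\<in>SO3. Y g \<in> L2_space M) \<and>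
     (\<forall>g\<in>SO3. \<forall>g1\<in>SO3. \<forall>g2\<in>SO3.
        L2_inner M (Y (g ** g1)) (Y (g ** g2)) = L2_inner M (Y g1) (Y g2))"

text \<open>An infinite orthonormal family need not exist in \<open>L\<^sup>2\<close> of the given probability space
  (which may even be a single point). As usual, the space is therefore enlarged by an
  independent, uniformly distributed variable; a variable \<open>Y\<close> on the original space becomes
  \<open>Y \<circ> fst\<close>.\<close>

definition enlarged :: "'w measure \<Rightarrow> ('w \<times> real) measure" where
  "enlarged M = M \<Otimes>\<^sub>M uniform_measure lborel {0..1}"

lemma prob_space_enlarged: "prob_space M \<Longrightarrow> prob_space (enlarged M)"
  unfolding enlarged_def
  by (intro prob_space_pair prob_space_uniform_measure) auto


section \<open>Tensor fields on the sphere in spherical coordinates\<close>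

definition sph :: "real \<Rightarrow> real \<Rightarrow> real^3" where
  "sph \<theta> \<phi> = vector [sin \<theta> * cos \<phi>, sin \<theta> * sin \<phi>, cos \<theta>]"

definition e_theta :: "real \<Rightarrow> real \<Rightarrow> real^3" where
  "e_theta \<theta> \<phi> = vector [cos \<theta> * cos \<phi>, cos \<theta> * sin \<phi>, - sin \<theta>]"

definition e_phi :: "real \<Rightarrow> real \<Rightarrow> real^3" where
  "e_phi \<theta> \<phi> = vector [- sin \<phi>, cos \<phi>, 0]"

text \<open>A (complex) tensor of rank 2 at a point is given by its matrix in the Cartesian basis.
  \<open>sph_comp X u v \<theta> \<phi>\<close> is its component along the moving unit vectors \<open>u\<close> and \<open>v\<close>, e.g.
  \<open>sph_comp X e_theta e_phi\<close> is \<open>X\<^sub>\<theta>\<^sub>\<phi>\<close>.\<close>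

definition sph_comp :: "(real^3 \<Rightarrow> 'w \<Rightarrow> complex^3^3) \<Rightarrow> (real \<Rightarrow> real \<Rightarrow> real^3) \<Rightarrow>
    (real \<Rightarrow> real \<Rightarrow> real^3) \<Rightarrow> real \<Rightarrow> real \<Rightarrow> 'w \<Rightarrow> complex" where
  "sph_comp X u v \<theta> \<phi> \<omega> =
     (\<Sum>i\<in>UNIV. \<Sum>j\<in>UNIV.
        complex_of_real (u \<theta> \<phi> $ i) * X (sph \<theta> \<phi>) \<omega> $ i $ j * complex_of_real (v \<theta> \<phi> $ j))"

definition tangential_sym_tracefree :: "'w measure \<Rightarrow> (real^3 \<Rightarrow> 'w \<Rightarrow> complex^3^3) \<Rightarrow> bool" where
  "tangential_sym_tracefree M X \<longleftrightarrow>
     (\<forall>\<theta> \<phi>. 0 < \<theta> \<and> \<theta> < pi \<longrightarrow>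
        (AE \<omega> in M. sph_comp X e_phi e_phi \<theta> \<phi> \<omega> + sph_comp X e_theta e_theta \<theta> \<phi> \<omega> = 0 \<and>
                   sph_comp X e_theta e_phi \<theta> \<phi> \<omega> = sph_comp X e_phi e_theta \<theta> \<phi> \<omega>))"

text \<open>The relation between the field and its representing functions on \<open>SO3\<close> is imposed for
  \<open>0 < \<theta> < \<pi>\<close> only, where the spherical basis is defined. The remaining rotations are those
  that fix or reverse the \<open>z\<close> axis; there the values are determined by mean square
  continuity.\<close>

definition represents_A ::
    "'w measure \<Rightarrow> (real^3 \<Rightarrow> 'w \<Rightarrow> complex^3^3) \<Rightarrow> (real^3^3 \<Rightarrow> 'w \<Rightarrow> complex) \<Rightarrow> bool" where
  "represents_A M X A \<longleftrightarrow>
     (\<forall>\<phi>1 \<theta> \<phi>2 \<phi>. 0 < \<theta> \<and> \<theta> < pi \<and> \<phi> = pi / 2 - \<phi>1 \<longrightarrow>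
        (AE \<omega> in M. A (euler \<phi>1 \<theta> \<phi>2) \<omega> =
           2 * (sph_comp X e_phi e_phi \<theta> \<phi> \<omega> + \<i> * sph_comp X e_theta e_phi \<theta> \<phi> \<omega>)
             * exp (2 * \<i> * complex_of_real \<phi>2)))"

definition represents_B ::
    "'w measure \<Rightarrow> (real^3 \<Rightarrow> 'w \<Rightarrow> complex^3^3) \<Rightarrow> (real^3^3 \<Rightarrow> 'w \<Rightarrow> complex) \<Rightarrow> bool" where
  "represents_B M X B \<longleftrightarrow>
     (\<forall>\<phi>1 \<theta> \<phi>2 \<phi>. 0 < \<theta> \<and> \<theta> < pi \<and> \<phi> = pi / 2 - \<phi>1 \<longrightarrow>
        (AE \<omega> in M. B (euler \<phi>1 \<theta> \<phi>2) \<omega> =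
           2 * (sph_comp X e_phi e_phi \<theta> \<phi> \<omega> - \<i> * sph_comp X e_theta e_phi \<theta> \<phi> \<omega>)
             * exp (- (2 * \<i> * complex_of_real \<phi>2))))"

end

theory Submission
  imports Defs
begin

text \<open>Let \<open>K u = E (Y 1 \<cdot> cnj (Y u))\<close>, so that isotropy reads
  \<open>E (Y g \<cdot> cnj (Y h)) = K (g\<^sup>-\<^sup>1 h)\<close>. The factor \<open>cis (j \<phi>\<^sub>2)\<close> in the definition of \<open>A\<close>
  (\<open>j = 2\<close>) and \<open>B\<close> (\<open>j = -2\<close>) makes \<open>K\<close> orthogonal to all matrix entries outside column
  \<open>j\<close>. The random variables are the normalised Fourier coefficients
  \<open>\<zeta>\<^sub>l\<^sub>m = \<integral> T\<^sup>l\<^sub>m\<^sub>j(g) Y(g) dg\<close>, taken in \<open>L\<^sup>2\<close>; Schur's lemma shows that they are orthogonal.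
  The squared error of the partial sums does not depend on \<open>g\<close> and equals
  \<open>K 1 - (\<Sum>l<L. |a\<^sub>l|\<^sup>2)\<close>, so everything reduces to completeness at the single point \<open>1\<close>: a
  continuous function orthogonal to all characters vanishes at \<open>1\<close>. The characters are known,
  since every rotation is conjugate to some \<open>rot_z \<alpha>\<close>, and multiplication by \<open>cos \<alpha>\<close> maps their
  span into itself; hence such a function is orthogonal to all powers of \<open>(1 + cos \<alpha>) / 2\<close>, which
  concentrate at \<open>1\<close>.\<close>

section \<open>Square-integrable random variables\<close>

text \<open>Random variables are functions here, not classes modulo null sets. An integral of
  \<open>Y\<close> over the group is therefore built from Riemann sums and known only through its
  inner products, and the later computations use nothing else. Every change of variables on the
  group is a left translation; it acts on the row label of a matrix entry and leaves the column
  label alone. Bessel's inequality comes for free, because the squared error is nonnegative. It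
  makes the series of the covariance converge uniformly, so \<open>K\<close> minus its series is
  continuous before anything is known about its values, and the completeness argument at
  \<open>1\<close> can be applied to it. A weight whose constant is zero has no coefficient that
  could be normalised. There the extra coordinate of \<open>enlarged M\<close> supplies variables of
  norm one, and the zero constant removes them from the series.\<close>

lemma L2_spaceD:
  assumes "Y \<in> L2_space M"
  shows "Y \<in> borel_measurable M" "integrable M (\<lambda>\<omega>. (cmod (Y \<omega>))\<^sup>2)"
  using assms by (auto simp: L2_space_def)

lemma two_mult_le: "2 * (x * y) \<le> x\<^sup>2 + (y::real)\<^sup>2"
  using sum_squares_bound[of x y] by simp

lemma L2_mult_integrable:
  assumes "X \<in> L2_space M" "Y \<in> L2_space M"
  shows "integrable M (\<lambda>\<omega>. X \<omega> * cnj (Y \<omega>))"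
proof (rule Bochner_Integration.integrable_bound)
  note [measurable] = L2_spaceD(1)[OF assms(1)] L2_spaceD(1)[OF assms(2)]
  show "integrable M (\<lambda>\<omega>. (cmod (X \<omega>))\<^sup>2 + (cmod (Y \<omega>))\<^sup>2)"
    using assms by (auto simp: L2_space_def)
  show "(\<lambda>\<omega>. X \<omega> * cnj (Y \<omega>)) \<in> borel_measurable M"
    by (intro borel_measurable_times L2_spaceD(1)[OF assms(1)]
        measurable_compose[OF L2_spaceD(1)[OF assms(2)]] borel_measurable_continuous_onI continuous_intros)
  have "cmod (X \<omega>) * cmod (Y \<omega>) \<le> (cmod (X \<omega>))\<^sup>2 + (cmod (Y \<omega>))\<^sup>2" for \<omega>
    using two_mult_le[of "cmod (X \<omega>)" "cmod (Y \<omega>)"] zero_le_mult_iff[of "cmod (X \<omega>)" "cmod (Y \<omega>)"]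
    by (smt (verit) norm_ge_zero)
  then show "AE \<omega> in M. norm (X \<omega> * cnj (Y \<omega>)) \<le> norm ((cmod (X \<omega>))\<^sup>2 + (cmod (Y \<omega>))\<^sup>2)"
    by (auto simp: norm_mult)
qed

lemma L2_space_add:
  assumes "X \<in> L2_space M" "Y \<in> L2_space M"
  shows "(\<lambda>\<omega>. X \<omega> + Y \<omega>) \<in> L2_space M"
proof -
  note [measurable] = L2_spaceD(1)[OF assms(1)] L2_spaceD(1)[OF assms(2)]
  have "integrable M (\<lambda>\<omega>. (cmod (X \<omega> + Y \<omega>))\<^sup>2)"
  proof (rule Bochner_Integration.integrable_bound)
    show "integrable M (\<lambda>\<omega>. 2 * (cmod (X \<omega>))\<^sup>2 + 2 * (cmod (Y \<omega>))\<^sup>2)"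
      using assms by (auto simp: L2_space_def)
    have "(cmod (X \<omega> + Y \<omega>))\<^sup>2 \<le> 2 * (cmod (X \<omega>))\<^sup>2 + 2 * (cmod (Y \<omega>))\<^sup>2" for \<omega>
    proof -
      have "(cmod (X \<omega> + Y \<omega>))\<^sup>2 \<le> (cmod (X \<omega>) + cmod (Y \<omega>))\<^sup>2"
        by (intro power_mono norm_triangle_ineq) auto
      also have "\<dots> \<le> 2 * (cmod (X \<omega>))\<^sup>2 + 2 * (cmod (Y \<omega>))\<^sup>2"
        using two_mult_le[of "cmod (X \<omega>)" "cmod (Y \<omega>)"] by (simp add: power2_sum)
      finally show ?thesis .
    qed
    then show "AE \<omega> in M. norm ((cmod (X \<omega> + Y \<omega>))\<^sup>2) \<le> norm (2 * (cmod (X \<omega>))\<^sup>2 + 2 * (cmod (Y \<omega>))\<^sup>2)"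
      by auto
  qed measurable
  then show ?thesis by (simp add: L2_space_def)
qed

lemma L2_space_cmult: "X \<in> L2_space M \<Longrightarrow> (\<lambda>\<omega>. c * X \<omega>) \<in> L2_space M"
  by (auto simp: L2_space_def norm_mult power_mult_distrib)

lemma L2_space_uminus: "X \<in> L2_space M \<Longrightarrow> (\<lambda>\<omega>. - X \<omega>) \<in> L2_space M"
  by (auto simp: L2_space_def)

lemma L2_space_zero: "(\<lambda>\<omega>. 0) \<in> L2_space M"
  by (auto simp: L2_space_def)

lemma L2_space_diff:
  "X \<in> L2_space M \<Longrightarrow> Y \<in> L2_space M \<Longrightarrow> (\<lambda>\<omega>. X \<omega> - Y \<omega>) \<in> L2_space M"
  using L2_space_add[OF _ L2_space_uminus, of X M Y] by simp

lemma L2_space_sum: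
  "(\<And>i. i \<in> I \<Longrightarrow> F i \<in> L2_space M) \<Longrightarrow> (\<lambda>\<omega>. \<Sum>i\<in>I. F i \<omega>) \<in> L2_space M"
  by (induction I rule: infinite_finite_induct) (auto intro: L2_space_zero L2_space_add)

lemmas L2_space_intros = L2_space_add L2_space_cmult L2_space_zero L2_space_diff L2_space_sum

lemma L2_inner_add_left:
  "X \<in> L2_space M \<Longrightarrow> Y \<in> L2_space M \<Longrightarrow> V \<in> L2_space M \<Longrightarrow>
   L2_inner M (\<lambda>\<omega>. X \<omega> + Y \<omega>) V = L2_inner M X V + L2_inner M Y V"
  unfolding L2_inner_def
  by (subst Bochner_Integration.integral_add[symmetric])
     (auto simp: algebra_simps L2_mult_integrable)

lemma L2_inner_cmult_left: "L2_inner M (\<lambda>\<omega>. c * X \<omega>) V = c * L2_inner M X V"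
  unfolding L2_inner_def by (simp add: mult.assoc)

lemma L2_inner_commute: "L2_inner M V X = cnj (L2_inner M X V)"
  unfolding L2_inner_def
  by (simp flip: Bochner_Integration.integral_cnj add: mult.commute)

lemma L2_inner_cmult_right: "L2_inner M V (\<lambda>\<omega>. c * X \<omega>) = cnj c * L2_inner M V X"
  by (subst (1 2) L2_inner_commute) (simp add: L2_inner_cmult_left)

lemma L2_inner_zero_left: "L2_inner M (\<lambda>\<omega>. 0) V = 0"
  by (simp add: L2_inner_def)

lemma L2_inner_diff_left:
  "X \<in> L2_space M \<Longrightarrow> Y \<in> L2_space M \<Longrightarrow> V \<in> L2_space M \<Longrightarrow>
   L2_inner M (\<lambda>\<omega>. X \<omega> - Y \<omega>) V = L2_inner M X V - L2_inner M Y V"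
  using L2_inner_add_left[of X M "\<lambda>\<omega>. (-1) * Y \<omega>" V]
  by (simp add: L2_space_uminus L2_inner_cmult_left[of M "-1", simplified])

lemma L2_inner_sum_left:
  "(\<And>i. i \<in> I \<Longrightarrow> F i \<in> L2_space M) \<Longrightarrow> V \<in> L2_space M \<Longrightarrow>
   L2_inner M (\<lambda>\<omega>. \<Sum>i\<in>I. F i \<omega>) V = (\<Sum>i\<in>I. L2_inner M (F i) V)"
  by (induction I rule: infinite_finite_induct)
     (auto simp: L2_inner_zero_left L2_inner_add_left L2_space_sum)

lemma L2_inner_diff_right:
  "X \<in> L2_space M \<Longrightarrow> Y \<in> L2_space M \<Longrightarrow> V \<in> L2_space M \<Longrightarrow>
   L2_inner M V (\<lambda>\<omega>. X \<omega> - Y \<omega>) = L2_inner M V X - L2_inner M V Y"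
  by (subst (1 2 3) L2_inner_commute) (simp add: L2_inner_diff_left)

lemma L2_inner_sum_right:
  "(\<And>i. i \<in> I \<Longrightarrow> F i \<in> L2_space M) \<Longrightarrow> V \<in> L2_space M \<Longrightarrow>
   L2_inner M V (\<lambda>\<omega>. \<Sum>i\<in>I. F i \<omega>) = (\<Sum>i\<in>I. L2_inner M V (F i))"
  by (subst (1 2) L2_inner_commute) (simp add: L2_inner_sum_left)

section \<open>Norm, Cauchy-Schwarz inequality and completeness\<close>

definition L2_norm :: "'w measure \<Rightarrow> ('w \<Rightarrow> complex) \<Rightarrow> real" where
  "L2_norm M X = sqrt (\<integral>\<omega>. (cmod (X \<omega>))\<^sup>2 \<partial>M)"

lemma L2_norm_nonneg: "L2_norm M X \<ge> 0"
  by (simp add: L2_norm_def)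

lemma L2_norm_square: "(L2_norm M X)\<^sup>2 = (\<integral>\<omega>. (cmod (X \<omega>))\<^sup>2 \<partial>M)"
  by (simp add: L2_norm_def)

lemma L2_inner_self: "L2_inner M X X = complex_of_real ((L2_norm M X)\<^sup>2)"
  unfolding L2_inner_def L2_norm_square
  by (simp only: complex_norm_square[symmetric] integral_complex_of_real)

lemma L2_sq_dist_norm: "L2_sq_dist M X Y = (L2_norm M (\<lambda>\<omega>. X \<omega> - Y \<omega>))\<^sup>2"
  by (simp add: L2_sq_dist_def L2_norm_square)

text \<open>Integrate the weighted inequality
  \<open>2 * x * y \<le> t * x\<^sup>2 + y\<^sup>2 / t\<close> with the weight \<open>t\<close> that
  balances the two norms. Both norms are shifted by a small \<open>d\<close>, since either of them
  may vanish.\<close>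

lemma L2_norm_mult_le:
  assumes "X \<in> L2_space M" "Y \<in> L2_space M"
  shows "(\<integral>\<omega>. cmod (X \<omega>) * cmod (Y \<omega>) \<partial>M) \<le> L2_norm M X * L2_norm M Y"
proof (rule field_le_epsilon)
  fix e :: real assume e: "e > 0"
  let ?a = "L2_norm M X" and ?b = "L2_norm M Y"
  \<comment> \<open>Chosen so that the shift costs at most \<open>e\<close>: the product
    \<open>(?a + d) * (?b + d)\<close> exceeds \<open>?a * ?b\<close> by
    \<open>d * (?a + ?b + d)\<close>, and \<open>d \<le> 1\<close>.\<close>
  define d where "d = min 1 (e / (?a + ?b + 1))"
  have ab: "?a \<ge> 0" "?b \<ge> 0" by (simp_all add: L2_norm_nonneg)
  have d: "0 < d" "d \<le> 1" "d * (?a + ?b + 1) \<le> e"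
    using e ab by (auto simp: d_def min_mult_distrib_right min.coboundedI2 add_nonneg_pos)
  define t where "t = (?b + d) / (?a + d)"
  have t: "t > 0" using ab d by (simp add: t_def)
  have int: "integrable M (\<lambda>\<omega>. cmod (X \<omega>) * cmod (Y \<omega>))"
    using integrable_norm[OF L2_mult_integrable[OF assms]] by (simp add: norm_mult)
  have pt: "cmod (X \<omega>) * cmod (Y \<omega>) \<le> (t * (cmod (X \<omega>))\<^sup>2 + (cmod (Y \<omega>))\<^sup>2 / t) / 2" for \<omega>
  proof -
    have "2 * ((sqrt t * cmod (X \<omega>)) * (cmod (Y \<omega>) / sqrt t))
        \<le> (sqrt t * cmod (X \<omega>))\<^sup>2 + (cmod (Y \<omega>) / sqrt t)\<^sup>2"
      by (rule two_mult_le)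
    then show ?thesis using t by (simp add: power_mult_distrib power_divide)
  qed
  have "(\<integral>\<omega>. cmod (X \<omega>) * cmod (Y \<omega>) \<partial>M)
      \<le> (\<integral>\<omega>. (t * (cmod (X \<omega>))\<^sup>2 + (cmod (Y \<omega>))\<^sup>2 / t) / 2 \<partial>M)"
    using int assms pt by (intro integral_mono) (auto simp: L2_space_def)
  also have "\<dots> = (t * ?a\<^sup>2 + ?b\<^sup>2 / t) / 2"
    using assms by (simp add: L2_space_def L2_norm_square)
  also have "\<dots> \<le> (t * (?a + d)\<^sup>2 + (?b + d)\<^sup>2 / t) / 2"
    using t ab d by (intro divide_right_mono add_mono mult_left_mono power_mono) auto
  also have "\<dots> = (?a + d) * (?b + d)"
  proof -
    have "?a + d > 0" "?b + d > 0" using ab d by auto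
    then show ?thesis by (simp add: t_def power2_eq_square)
  qed
  also have "\<dots> = ?a * ?b + d * (?a + ?b + d)" by (simp add: algebra_simps)
  also have "\<dots> \<le> ?a * ?b + d * (?a + ?b + 1)" using d by (intro add_left_mono mult_left_mono) auto
  also have "\<dots> \<le> ?a * ?b + e" using d by simp
  finally show "(\<integral>\<omega>. cmod (X \<omega>) * cmod (Y \<omega>) \<partial>M) \<le> ?a * ?b + e" .
qed

lemma L2_Cauchy_Schwarz:
  assumes "X \<in> L2_space M" "Y \<in> L2_space M"
  shows "cmod (L2_inner M X Y) \<le> L2_norm M X * L2_norm M Y"
proof -
  have "cmod (L2_inner M X Y) \<le> (\<integral>\<omega>. cmod (X \<omega>) * cmod (Y \<omega>) \<partial>M)"
    unfolding L2_inner_def using integral_norm_bound[of M "\<lambda>\<omega>. X \<omega> * cnj (Y \<omega>)"]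
    by (simp add: norm_mult)
  with L2_norm_mult_le[OF assms] show ?thesis by simp
qed

lemma L2_norm_diff_commute: "L2_norm M (\<lambda>\<omega>. X \<omega> - Y \<omega>) = L2_norm M (\<lambda>\<omega>. Y \<omega> - X \<omega>)"
  by (simp add: L2_norm_def norm_minus_commute)

text \<open>Cauchy-Schwarz makes the inner product continuous. The filter is arbitrary because both
  limits over the group and limits of sequences are needed.\<close>

lemma L2_inner_tendsto_left:
  assumes "\<forall>\<^sub>F x in F. f x \<in> L2_space M" "Y \<in> L2_space M" "V \<in> L2_space M"
    and "((\<lambda>x. L2_sq_dist M (f x) Y) \<longlongrightarrow> 0) F"
  shows "((\<lambda>x. L2_inner M (f x) V) \<longlongrightarrow> L2_inner M Y V) F"
proof (rule Lim_null[THEN iffD2], rule tendsto_norm_zero_cancel, rule Lim_null_comparison)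
  show "((\<lambda>x. sqrt (L2_sq_dist M (f x) Y) * L2_norm M V) \<longlongrightarrow> 0) F"
    using tendsto_mult[OF tendsto_real_sqrt[OF assms(4)] tendsto_const[of "L2_norm M V"]] by simp
  show "\<forall>\<^sub>F x in F. norm (cmod (L2_inner M (f x) V - L2_inner M Y V)) \<le> sqrt (L2_sq_dist M (f x) Y) * L2_norm M V"
    using assms(1)
  proof eventually_elim
    case (elim x)
    have "L2_inner M (f x) V - L2_inner M Y V = L2_inner M (\<lambda>\<omega>. f x \<omega> - Y \<omega>) V"
      using elim assms by (simp add: L2_inner_diff_left)
    then show ?case
      using L2_Cauchy_Schwarz[OF L2_space_diff[OF elim assms(2)] assms(3)]
      by (simp add: L2_sq_dist_norm L2_norm_nonneg)
  qed
qed

text \<open>The Riesz-Fischer argument. On a probability space the L1 norm is at most the L2 norm,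
  so the increments have summable expectations and the sequence converges almost everywhere. A
  geometric rate in the hypothesis spares the passage to a subsequence.\<close>

lemma L2_fast_Cauchy_converges:
  assumes "prob_space M"
    and F: "\<And>n. F n \<in> L2_space M"
    and C: "\<And>m n. n \<le> m \<Longrightarrow> L2_norm M (\<lambda>\<omega>. F n \<omega> - F m \<omega>) \<le> C / 2 ^ n"
  obtains Y where "Y \<in> L2_space M" "(\<lambda>n. L2_sq_dist M (F n) Y) \<longlonglongrightarrow> 0"
proof -
  interpret prob_space M by fact
  note [measurable] = L2_spaceD(1)[OF F]
  have one: "(\<lambda>_. 1) \<in> L2_space M" by (simp add: L2_space_def)
  have C0: "C \<ge> 0" using C[of 0 0] L2_norm_nonneg[of M "\<lambda>\<omega>. F 0 \<omega> - F 0 \<omega>"] by simp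
  have L1: "integrable M (\<lambda>\<omega>. cmod (F (Suc n) \<omega> - F n \<omega>))"
      "(\<integral>\<omega>. cmod (F (Suc n) \<omega> - F n \<omega>) \<partial>M) \<le> C / 2 ^ n" for n
  proof -
    have D: "(\<lambda>\<omega>. F (Suc n) \<omega> - F n \<omega>) \<in> L2_space M" by (intro L2_space_diff F)
    show "integrable M (\<lambda>\<omega>. cmod (F (Suc n) \<omega> - F n \<omega>))"
      using integrable_norm[OF L2_mult_integrable[OF D one]] by simp
    have "L2_norm M (\<lambda>_. 1) = 1" by (simp add: L2_norm_def prob_space)
    then have "(\<integral>\<omega>. cmod (F (Suc n) \<omega> - F n \<omega>) \<partial>M) \<le> L2_norm M (\<lambda>\<omega>. F (Suc n) \<omega> - F n \<omega>)"
      using L2_norm_mult_le[OF D one] by simp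
    with C[of n "Suc n"] show "(\<integral>\<omega>. cmod (F (Suc n) \<omega> - F n \<omega>) \<partial>M) \<le> C / 2 ^ n"
      by (simp add: L2_norm_diff_commute)
  qed
  have "(\<integral>\<^sup>+\<omega>. (\<Sum>n. ennreal (cmod (F (Suc n) \<omega> - F n \<omega>))) \<partial>M)
      = (\<Sum>n. ennreal (\<integral>\<omega>. cmod (F (Suc n) \<omega> - F n \<omega>) \<partial>M))"
    by (subst nn_integral_suminf) (auto simp: nn_integral_eq_integral L1(1))
  also have "\<dots> \<le> (\<Sum>n. ennreal (C * (1/2) ^ n))"
    using L1(2) by (intro suminf_le) (auto simp: field_simps power_one_over intro!: ennreal_leI)
  also have "\<dots> = ennreal (\<Sum>n. C * (1/2) ^ n)"
    using C0 by (intro suminf_ennreal2) (auto intro!: summable_mult)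
  finally have "(\<integral>\<^sup>+\<omega>. (\<Sum>n. ennreal (cmod (F (Suc n) \<omega> - F n \<omega>))) \<partial>M) \<noteq> \<infinity>"
    by (simp add: top.extremum_unique top_unique)
       (metis ennreal_less_top less_top neq_top_trans)
  then have "AE \<omega> in M. (\<Sum>n. ennreal (cmod (F (Suc n) \<omega> - F n \<omega>))) \<noteq> \<infinity>"
    by (intro nn_integral_PInf_AE) auto
  then have conv: "AE \<omega> in M. convergent (\<lambda>n. F n \<omega>)"
  proof eventually_elim
    case (elim \<omega>)
    then have "summable (\<lambda>n. norm (F (Suc n) \<omega> - F n \<omega>))"
      by (intro summable_suminf_not_top) auto
    then have "summable (\<lambda>n. F (Suc n) \<omega> - F n \<omega>)" by (rule summable_norm_cancel)
    then have "convergent (\<lambda>n. \<Sum>i<n. F (Suc i) \<omega> - F i \<omega>)" by (simp add: summable_iff_convergent)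
    then have "convergent (\<lambda>n. F n \<omega> - F 0 \<omega>)"
      by (simp add: sum_lessThan_telescope[of "\<lambda>n. F n \<omega>"])
    then have "convergent (\<lambda>n. (F n \<omega> - F 0 \<omega>) + F 0 \<omega>)"
      by (intro convergent_add convergent_const)
    then show ?case by simp
  qed
  \<comment> \<open>Where the sequence diverges \<open>lim\<close> has an unspecified value; this is
    a null set and affects no integral.\<close>
  define Y where "Y \<omega> = lim (\<lambda>n. F n \<omega>)" for \<omega>
  have [measurable]: "Y \<in> borel_measurable M" unfolding Y_def by measurable
  have lim: "AE \<omega> in M. (\<lambda>n. F n \<omega>) \<longlonglongrightarrow> Y \<omega>"
    using conv by (auto simp: Y_def convergent_LIMSEQ_iff)
  \<comment> \<open>Fatou's lemma in \<open>m\<close> for fixed \<open>n\<close>: the Cauchy bound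
    passes to the limit.\<close>
  have nn: "(\<integral>\<^sup>+\<omega>. ennreal ((cmod (F n \<omega> - Y \<omega>))\<^sup>2) \<partial>M) \<le> ennreal ((C / 2 ^ n)\<^sup>2)" for n
  proof -
    have "(\<integral>\<^sup>+\<omega>. ennreal ((cmod (F n \<omega> - Y \<omega>))\<^sup>2) \<partial>M)
        = (\<integral>\<^sup>+\<omega>. liminf (\<lambda>m. ennreal ((cmod (F n \<omega> - F m \<omega>))\<^sup>2)) \<partial>M)"
    proof (rule nn_integral_cong_AE)
      show "AE \<omega> in M. ennreal ((cmod (F n \<omega> - Y \<omega>))\<^sup>2) = liminf (\<lambda>m. ennreal ((cmod (F n \<omega> - F m \<omega>))\<^sup>2))"
        using lim
      proof eventually_elim
        case (elim \<omega>)
        have "(\<lambda>m. ennreal ((cmod (F n \<omega> - F m \<omega>))\<^sup>2)) \<longlonglongrightarrow> ennreal ((cmod (F n \<omega> - Y \<omega>))\<^sup>2)"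
          by (intro tendsto_intros elim tendsto_ennrealI)
        then show ?case by (rule lim_imp_Liminf[symmetric, rotated]) auto
      qed
    qed
    also have "\<dots> \<le> liminf (\<lambda>m. \<integral>\<^sup>+\<omega>. ennreal ((cmod (F n \<omega> - F m \<omega>))\<^sup>2) \<partial>M)"
      by (rule nn_integral_liminf) measurable
    also have "\<dots> \<le> ennreal ((C / 2 ^ n)\<^sup>2)"
    proof (rule Liminf_le)
      show "\<forall>\<^sub>F m in sequentially. (\<integral>\<^sup>+\<omega>. ennreal ((cmod (F n \<omega> - F m \<omega>))\<^sup>2) \<partial>M) \<le> ennreal ((C / 2 ^ n)\<^sup>2)"
        using eventually_ge_at_top[of n]
      proof eventually_elim
        case (elim m)
        have "(\<integral>\<^sup>+\<omega>. ennreal ((cmod (F n \<omega> - F m \<omega>))\<^sup>2) \<partial>M) = ennreal ((L2_norm M (\<lambda>\<omega>. F n \<omega> - F m \<omega>))\<^sup>2)"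
          unfolding L2_norm_square
          by (rule nn_integral_eq_integral) (use L2_spaceD(2)[OF L2_space_diff[OF F F]] in auto)
        also have "\<dots> \<le> ennreal ((C / 2 ^ n)\<^sup>2)"
          using C[OF elim] by (intro ennreal_leI power_mono) (auto simp: L2_norm_nonneg)
        finally show ?case .
      qed
    qed simp
    finally show ?thesis .
  qed
  have D: "(\<lambda>\<omega>. F n \<omega> - Y \<omega>) \<in> L2_space M" for n
    unfolding L2_space_def
    by (auto intro!: integrableI_bounded order.strict_trans1[OF nn[of n]])
  have Y: "Y \<in> L2_space M" using L2_space_diff[OF F[of 0] D[of 0]] by simp
  have le: "L2_sq_dist M (F n) Y \<le> (C / 2 ^ n)\<^sup>2" for n
  proof -
    have "ennreal (L2_sq_dist M (F n) Y) \<le> ennreal ((C / 2 ^ n)\<^sup>2)"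
      unfolding L2_sq_dist_def
      by (subst nn_integral_eq_integral[symmetric]) (use nn[of n] L2_spaceD(2)[OF D] in auto)
    then show ?thesis by simp
  qed
  have "(\<lambda>n. (C * (1/2) ^ n)\<^sup>2) \<longlonglongrightarrow> (C * 0)\<^sup>2"
    by (intro tendsto_intros LIMSEQ_power_zero) auto
  then have lim0: "(\<lambda>n. (C / 2 ^ n)\<^sup>2) \<longlonglongrightarrow> 0" by (simp add: power_one_over field_simps)
  have "(\<lambda>n. L2_sq_dist M (F n) Y) \<longlonglongrightarrow> 0"
  proof (rule Lim_null_comparison[OF always_eventually lim0], rule allI)
    show "norm (L2_sq_dist M (F n) Y) \<le> (C / 2 ^ n)\<^sup>2" for n
      using le[of n] by (simp add: L2_sq_dist_norm)
  qed
  with Y that show thesis by blast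
qed

section \<open>Weak integrals of mean square continuous maps\<close>

lemma continuous_on_L2_inner_left:
  fixes S :: "'a::metric_space set"
  assumes Y: "\<And>g. g \<in> S \<Longrightarrow> Y g \<in> L2_space M"
    and cont: "\<And>g. g \<in> S \<Longrightarrow> ((\<lambda>h. L2_sq_dist M (Y h) (Y g)) \<longlongrightarrow> 0) (at g within S)"
    and V: "V \<in> L2_space M"
  shows "continuous_on S (\<lambda>g. L2_inner M (Y g) V)"
  unfolding continuous_on_def
proof
  fix g assume g: "g \<in> S"
  have "\<forall>\<^sub>F h in at g within S. Y h \<in> L2_space M"
    using Y by (auto simp: eventually_at_filter)
  then show "((\<lambda>g. L2_inner M (Y g) V) \<longlongrightarrow> L2_inner M (Y g) V) (at g within S)"
    by (rule L2_inner_tendsto_left[OF _ Y[OF g] V cont[OF g]])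
qed

lemma integrable_continuous_on_compact:
  fixes S :: "'a::metric_space set" and f :: "'a \<Rightarrow> 'b::{banach, second_countable_topology}"
  assumes "prob_space \<mu>" and sets: "sets \<mu> = sets (restrict_space borel S)"
    and "compact S" "continuous_on S f"
  shows "integrable \<mu> f"
proof -
  interpret prob_space \<mu> by fact
  have sp: "space \<mu> = S" using sets_eq_imp_space_eq[OF sets] by (simp add: space_restrict_space)
  obtain B where B: "\<And>g. g \<in> S \<Longrightarrow> norm (f g) \<le> B"
    using compact_imp_bounded[OF compact_continuous_image[OF assms(4,3)]] by (auto simp: bounded_iff)
  have "f \<in> borel_measurable \<mu>"
    using borel_measurable_continuous_on_restrict[OF assms(4)] measurable_cong_sets[OF sets refl] by blast
  then show ?thesis using B by (intro integrable_const_bound[of _ B]) (auto simp: sp)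
qed

text \<open>\<open>J\<close> is a Riemann sum. By compactness \<open>S\<close> is covered by
  finitely many open sets on each of which \<open>Y\<close> stays within \<open>e\<close> of one of
  its values; made disjoint, they form a measurable partition. The error is proportional to
  \<open>L2_norm M V\<close> with a factor independent of \<open>V\<close>, and this forces such
  sums to be Cauchy in norm.\<close>

lemma weak_L2_integral_approx:
  fixes S :: "'a::metric_space set"
  assumes "prob_space \<mu>" and sets: "sets \<mu> = sets (restrict_space borel S)"
    and "compact S"
    and Y: "\<And>g. g \<in> S \<Longrightarrow> Y g \<in> L2_space M"
    and cont: "\<And>g. g \<in> S \<Longrightarrow> ((\<lambda>h. L2_sq_dist M (Y h) (Y g)) \<longlongrightarrow> 0) (at g within S)"
    and e: "e > 0"
  obtains J where "J \<in> L2_space M"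
    "\<And>V. V \<in> L2_space M \<Longrightarrow> cmod (L2_inner M J V - (\<integral>g. L2_inner M (Y g) V \<partial>\<mu>)) \<le> e * L2_norm M V"
proof -
  interpret prob_space \<mu> by fact
  have sp: "space \<mu> = S" using sets_eq_imp_space_eq[OF sets] by (simp add: space_restrict_space)
  have "\<exists>U. open U \<and> g \<in> U \<and> (\<forall>h\<in>U \<inter> S. L2_norm M (\<lambda>\<omega>. Y h \<omega> - Y g \<omega>) \<le> e)" if g: "g \<in> S" for g
  proof -
    have "\<forall>\<^sub>F h in at g within S. L2_sq_dist M (Y h) (Y g) < e\<^sup>2"
      using e by (intro order_tendstoD[OF cont[OF g]]) auto
    then obtain U where U: "open U" "g \<in> U" "\<And>h. h \<in> U \<Longrightarrow> h \<noteq> g \<Longrightarrow> h \<in> S \<Longrightarrow> L2_sq_dist M (Y h) (Y g) < e\<^sup>2"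
      unfolding eventually_at_topological by auto
    have "L2_norm M (\<lambda>\<omega>. Y h \<omega> - Y g \<omega>) \<le> e" if "h \<in> U \<inter> S" for h
    proof (cases "h = g")
      case True
      then show ?thesis using e by (simp add: L2_norm_def)
    next
      case False
      then show ?thesis using U(3)[of h] that e
        by (auto simp: L2_sq_dist_norm intro: power2_le_imp_le)
    qed
    with U show ?thesis by blast
  qed
  then obtain U where U: "\<And>g. g \<in> S \<Longrightarrow> open (U g) \<and> g \<in> U g"
      "\<And>g h. g \<in> S \<Longrightarrow> h \<in> U g \<Longrightarrow> h \<in> S \<Longrightarrow> L2_norm M (\<lambda>\<omega>. Y h \<omega> - Y g \<omega>) \<le> e"
    by (metis IntI)
  obtain C where C: "C \<subseteq> S" "finite C" "S \<subseteq> (\<Union>c\<in>C. U c)"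
    by (rule compactE_image[OF \<open>compact S\<close>, of S U]) (use U in auto)
  obtain n :: nat and cs where cs: "C = cs ` {i. i < n}"
    using finite_imp_nat_seg_image_inj_on[OF C(2)] by auto
  \<comment> \<open>Padding by the empty set turns the finite cover into a sequence, as
    \<open>disjointed\<close> expects.\<close>
  define W where "W = (\<lambda>i. if i < n then U (cs i) else {})"
  define Q where "Q i = disjointed W i \<inter> S" for i
  have csS: "cs i \<in> S" if "i < n" for i using C(1) cs that by auto
  have Wopen: "open (W i)" for i using U(1) csS by (auto simp: W_def)
  have "disjointed W i \<in> sets borel" for i
    using Wopen by (auto simp: disjointed_def intro!: sets.Diff sets.finite_UN)
  then have Qm[measurable]: "Q i \<in> sets \<mu>" for i
    by (auto simp: Q_def sets sets_restrict_space)
  have disj: "disjoint_family Q"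
    using disjoint_family_disjointed[of W] by (auto simp: disjoint_family_on_def Q_def)
  have cover: "\<exists>i<n. g \<in> Q i" if "g \<in> S" for g
  proof -
    have "g \<in> (\<Union>i\<in>{0..<n}. W i)" using that C(3) cs by (force simp: W_def)
    then have "g \<in> (\<Union>i\<in>{0..<n}. disjointed W i)" by (simp only: finite_UN_disjointed_eq)
    then show ?thesis using that by (auto simp: Q_def)
  qed
  have near: "L2_norm M (\<lambda>\<omega>. Y g \<omega> - Y (cs i) \<omega>) \<le> e" if "g \<in> Q i" "i < n" for g i
    using that disjointed_subset[of W i] U(2)[OF csS[OF that(2)]] by (auto simp: Q_def W_def)
  define J where "J = (\<lambda>\<omega>. \<Sum>i<n. complex_of_real (prob (Q i)) * Y (cs i) \<omega>)"
  have J: "J \<in> L2_space M" unfolding J_def by (intro L2_space_intros Y csS) auto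
  show thesis
  proof (rule that[OF J])
    fix V assume V: "V \<in> L2_space M"
    define h where "h g = (\<Sum>i<n. indicat_real (Q i) g *\<^sub>R L2_inner M (Y (cs i)) V)" for g
    have hi: "integrable \<mu> h" unfolding h_def
      by (intro Bochner_Integration.integrable_sum integrable_scaleR_left) (auto simp: less_top[symmetric])
    have "(\<integral>g. h g \<partial>\<mu>) = (\<Sum>i<n. prob (Q i) *\<^sub>R L2_inner M (Y (cs i)) V)"
      unfolding h_def
      by (subst Bochner_Integration.integral_sum) (auto simp: less_top[symmetric])
    also have "\<dots> = L2_inner M J V"
      unfolding J_def using V Y csS
      by (subst L2_inner_sum_left) (auto intro!: L2_space_intros simp: L2_inner_cmult_left scaleR_conv_of_real)
    finally have hint: "(\<integral>g. h g \<partial>\<mu>) = L2_inner M J V" .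
    have close: "cmod (h g - L2_inner M (Y g) V) \<le> e * L2_norm M V" if g: "g \<in> S" for g
    proof -
      obtain i where i: "i < n" "g \<in> Q i" using cover[OF g] by auto
      have "h g = (\<Sum>k<n. if k = i then L2_inner M (Y (cs i)) V else 0)"
        unfolding h_def
      proof (rule sum.cong[OF refl])
        fix k assume "k \<in> {..<n}"
        show "indicat_real (Q k) g *\<^sub>R L2_inner M (Y (cs k)) V = (if k = i then L2_inner M (Y (cs i)) V else 0)"
          using disj i by (cases "k = i") (auto simp: disjoint_family_on_def indicator_def)
      qed
      also have "\<dots> = L2_inner M (Y (cs i)) V" using i by simp
      finally have "h g - L2_inner M (Y g) V = - L2_inner M (\<lambda>\<omega>. Y g \<omega> - Y (cs i) \<omega>) V"
        using V Y csS i g by (simp add: L2_inner_diff_left)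
      then have "cmod (h g - L2_inner M (Y g) V) \<le> L2_norm M (\<lambda>\<omega>. Y g \<omega> - Y (cs i) \<omega>) * L2_norm M V"
        using L2_Cauchy_Schwarz[OF L2_space_diff[OF Y[OF g] Y[OF csS[OF i(1)]]] V] by simp
      also have "\<dots> \<le> e * L2_norm M V"
        using near[OF i(2,1)] by (intro mult_right_mono L2_norm_nonneg)
      finally show ?thesis .
    qed
    have iY: "integrable \<mu> (\<lambda>g. L2_inner M (Y g) V)"
      by (intro integrable_continuous_on_compact[OF assms(1-3)] continuous_on_L2_inner_left Y cont V)
    have "L2_inner M J V - (\<integral>g. L2_inner M (Y g) V \<partial>\<mu>) = (\<integral>g. h g - L2_inner M (Y g) V \<partial>\<mu>)"
      using hi iY hint by simp
    also have "cmod \<dots> \<le> (\<integral>g. cmod (h g - L2_inner M (Y g) V) \<partial>\<mu>)" by (rule integral_norm_bound)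
    also have "\<dots> \<le> (\<integral>g. e * L2_norm M V \<partial>\<mu>)"
      using hi iY close by (intro integral_mono integrable_norm Bochner_Integration.integrable_diff) (auto simp: sp)
    finally show "cmod (L2_inner M J V - (\<integral>g. L2_inner M (Y g) V \<partial>\<mu>)) \<le> e * L2_norm M V"
      by (simp add: prob_space)
  qed
qed

lemma weak_L2_integral:
  fixes S :: "'a::metric_space set"
  assumes M: "prob_space M"
    and "prob_space \<mu>" "sets \<mu> = sets (restrict_space borel S)" "compact S"
    and "\<And>g. g \<in> S \<Longrightarrow> Y g \<in> L2_space M"
    and "\<And>g. g \<in> S \<Longrightarrow> ((\<lambda>h. L2_sq_dist M (Y h) (Y g)) \<longlongrightarrow> 0) (at g within S)"
  obtains \<zeta> where "\<zeta> \<in> L2_space M"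
    "\<And>V. V \<in> L2_space M \<Longrightarrow> L2_inner M \<zeta> V = (\<integral>g. L2_inner M (Y g) V \<partial>\<mu>)"
proof -
  let ?I = "\<lambda>V. \<integral>g. L2_inner M (Y g) V \<partial>\<mu>"
  have "\<exists>J. J \<in> L2_space M \<and> (\<forall>V\<in>L2_space M. cmod (L2_inner M J V - ?I V) \<le> 1 / 2 ^ n * L2_norm M V)" for n :: nat
    by (rule weak_L2_integral_approx[OF assms(2-6), of "1 / 2 ^ n"]) auto
  then obtain J where J: "\<And>n. J n \<in> L2_space M"
      "\<And>n V. V \<in> L2_space M \<Longrightarrow> cmod (L2_inner M (J n) V - ?I V) \<le> 1 / 2 ^ n * L2_norm M V"
    by metis
  have "L2_norm M (\<lambda>\<omega>. J n \<omega> - J m \<omega>) \<le> 2 / 2 ^ n" if "n \<le> m" for n m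
  proof -
    \<comment> \<open>Testing the two weak bounds against the difference itself turns them into a
      bound on its norm.\<close>
    define D where "D = (\<lambda>\<omega>. J n \<omega> - J m \<omega>)"
    have D: "D \<in> L2_space M" unfolding D_def by (intro L2_space_diff J)
    have "(L2_norm M D)\<^sup>2 = cmod (L2_inner M D D)" by (simp add: L2_inner_self norm_power)
    also have "L2_inner M D D = (L2_inner M (J n) D - ?I D) - (L2_inner M (J m) D - ?I D)"
      using L2_inner_diff_left[OF J(1) J(1) D, of n m] by (simp add: D_def)
    also have "cmod \<dots> \<le> 1 / 2 ^ n * L2_norm M D + 1 / 2 ^ m * L2_norm M D"
      by (rule order_trans[OF norm_triangle_ineq4]) (intro add_mono J D)
    also have "\<dots> \<le> 1 / 2 ^ n * L2_norm M D + 1 / 2 ^ n * L2_norm M D"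
      using that by (intro add_mono mult_right_mono L2_norm_nonneg order.refl divide_left_mono) auto
    finally have "L2_norm M D * L2_norm M D \<le> (2 / 2 ^ n) * L2_norm M D"
      by (simp add: power2_eq_square)
    then have "L2_norm M D \<le> 2 / 2 ^ n"
      using L2_norm_nonneg[of M D] by (cases "L2_norm M D = 0") (auto intro: mult_right_le_imp_le)
    then show ?thesis by (simp add: D_def)
  qed
  then obtain \<zeta> where \<zeta>: "\<zeta> \<in> L2_space M" "(\<lambda>n. L2_sq_dist M (J n) \<zeta>) \<longlonglongrightarrow> 0"
    by (rule L2_fast_Cauchy_converges[OF M J(1)])
  show thesis
  proof (rule that[OF \<zeta>(1)])
    fix V assume V: "V \<in> L2_space M"
    have "(\<lambda>n. L2_inner M (J n) V) \<longlonglongrightarrow> L2_inner M \<zeta> V"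
      using J \<zeta> V by (intro L2_inner_tendsto_left) auto
    moreover have "(\<lambda>n. L2_inner M (J n) V) \<longlonglongrightarrow> ?I V"
    proof (rule Lim_null[THEN iffD2], rule Lim_null_comparison)
      show "\<forall>\<^sub>F n in sequentially. norm (L2_inner M (J n) V - ?I V) \<le> L2_norm M V * (1/2) ^ n"
        using J(2)[OF V] by (auto simp: power_one_over field_simps)
      show "(\<lambda>n. L2_norm M V * (1/2) ^ n) \<longlonglongrightarrow> 0"
        by (intro tendsto_mult_right_zero LIMSEQ_power_zero) auto
    qed
    ultimately show "L2_inner M \<zeta> V = ?I V" by (rule LIMSEQ_unique)
  qed
qed

section \<open>A left-invariant measure on the rotation group\<close>

lemma SO3_one: "mat 1 \<in> SO3"
  by (simp add: SO3_def rotation_matrix_def orthogonal_matrix_id)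

lemma SO3_mult: "g \<in> SO3 \<Longrightarrow> h \<in> SO3 \<Longrightarrow> g ** h \<in> SO3"
  by (simp add: SO3_def rotation_matrix_def orthogonal_matrix_mul det_mul)

lemma SO3_transpose: "g \<in> SO3 \<Longrightarrow> transpose g \<in> SO3"
  by (simp add: SO3_def rotation_matrix_def)

lemma SO3_transpose_mult:
  assumes "g \<in> SO3"
  shows "transpose g ** g = mat 1" "g ** transpose g = mat 1"
  using assms by (auto simp: SO3_def rotation_matrix_def orthogonal_matrix_def)

lemma SO3_matrix_inv:
  assumes "g \<in> SO3"
  shows "matrix_inv g = transpose g"
proof -
  have "invertible g" unfolding invertible_def using SO3_transpose_mult[OF assms] by blast
  then have "transpose g = transpose g ** (g ** matrix_inv g)"
    using someI_ex[of "\<lambda>A'. g ** A' = mat 1 \<and> A' ** g = mat 1"]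
    by (simp add: matrix_inv_def invertible_def)
  then show ?thesis using SO3_transpose_mult[OF assms] by (simp add: matrix_mul_assoc)
qed

lemma continuous_on_matrix_mult [continuous_intros]:
  fixes f :: "'a::topological_space \<Rightarrow> real^'n^'m" and g :: "'a \<Rightarrow> real^'k^'n"
  assumes "continuous_on S f" "continuous_on S g"
  shows "continuous_on S (\<lambda>x. f x ** g x)"
  unfolding matrix_matrix_mult_def by (intro continuous_intros assms)

lemma continuous_on_matrix_vector_mult [continuous_intros]:
  fixes f :: "'a::topological_space \<Rightarrow> real^'n^'m" and g :: "'a \<Rightarrow> real^'n"
  assumes "continuous_on S f" "continuous_on S g"
  shows "continuous_on S (\<lambda>x. f x *v g x)"
  unfolding matrix_vector_mult_def by (intro continuous_intros assms)

lemma continuous_on_transpose [continuous_intros]: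
  fixes f :: "'a::topological_space \<Rightarrow> real^'n^'m"
  assumes "continuous_on S f"
  shows "continuous_on S (\<lambda>x. transpose (f x))"
  unfolding transpose_def by (intro continuous_intros assms)

lemma compact_SO3: "compact SO3"
proof -
  have cont_det: "continuous_on UNIV (\<lambda>g :: real^3^3. det g)"
    unfolding det_3 by (intro continuous_intros)
  have SO3_eq: "SO3 = {g :: real^3^3. transpose g ** g = mat 1} \<inter> {g. det g = 1}"
    by (auto simp: SO3_def rotation_matrix_def orthogonal_matrix)
  moreover have "closed {g :: real^3^3. transpose g ** g = mat 1}"
    by (intro closed_Collect_eq continuous_intros)
  moreover have "closed {g :: real^3^3. det g = 1}"
    by (intro closed_Collect_eq cont_det continuous_intros)
  ultimately have "closed SO3" unfolding SO3_eq by (intro closed_Int)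
  moreover have "norm g \<le> 3" if "g \<in> SO3" for g
  proof -
    have "norm (g $ i) = 1" for i
      using that orthogonal_matrix_orthonormal_rows[of g]
      by (auto simp: SO3_def rotation_matrix_def row_def)
    then have "(\<Sum>i\<in>UNIV. norm (g $ i)) = 3" by (simp add: sum_3)
    moreover have "norm g \<le> (\<Sum>i\<in>UNIV. norm (g $ i))"
      unfolding norm_vec_def by (rule L2_set_le_sum) simp
    ultimately show ?thesis by linarith
  qed
  then have "bounded SO3" by (auto simp: bounded_iff)
  ultimately show ?thesis by (simp add: compact_eq_bounded_closed)
qed

text \<open>Boxes determine \<open>lborel\<close>. The preimage of a box under \<open>h\<close> is
  its image under the transpose, and orthogonal maps preserve Lebesgue measure.\<close>

lemma lborel_distr_orthogonal_matrix:
  fixes h :: "real^3^3"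
  assumes "orthogonal_matrix h"
  shows "distr lborel borel (\<lambda>v. h *v v) = lborel"
proof (rule lborel_eqI[symmetric])
  have meas: "(\<lambda>v. h *v v) \<in> borel_measurable borel"
    by (intro borel_measurable_continuous_onI continuous_intros)
  fix l u :: "real^3" assume lu: "\<And>b. b \<in> Basis \<Longrightarrow> l \<bullet> b \<le> u \<bullet> b"
  define k where "k = transpose h"
  have k: "k ** h = mat 1" "h ** k = mat 1"
    using assms by (auto simp: k_def orthogonal_matrix_def)
  have o: "orthogonal_transformation (\<lambda>v. k *v v)"
    using assms by (simp add: orthogonal_transformation_matrix k_def del: transpose_matrix_vector)
  have "(\<lambda>v. h *v v) -` box l u = (\<lambda>v. k *v v) ` box l u"
  proof (intro set_eqI iffI)
    fix v assume "v \<in> (\<lambda>v. h *v v) -` box l u"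
    moreover have "v = k *v (h *v v)" by (simp add: matrix_vector_mul_assoc k)
    ultimately show "v \<in> (\<lambda>v. k *v v) ` box l u" by auto
  qed (auto simp: matrix_vector_mul_assoc k)
  moreover have "emeasure lborel ((\<lambda>v. h *v v) -` box l u) = emeasure lebesgue ((\<lambda>v. h *v v) -` box l u)"
    using measurable_sets[OF meas, of "box l u"] by (subst emeasure_completion) auto
  moreover have "emeasure lebesgue ((\<lambda>v. k *v v) ` box l u) = emeasure lebesgue (box l u)"
    using measure_orthogonal_image[OF o, of "box l u"] measurable_orthogonal_image[OF o, of "box l u"]
    by (simp add: emeasure_eq_measure2 fmeasurableD2)
  ultimately have "emeasure lborel ((\<lambda>v. h *v v) -` box l u) = emeasure lborel (box l u)"
    by simp
  then show "emeasure (distr lborel borel (\<lambda>v. h *v v)) (box l u) = ennreal (\<Prod>b\<in>Basis. (u - l) \<bullet> b)"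
    using meas lu by (simp add: emeasure_distr)
qed simp

lemma emeasure_lborel_open_pos:
  fixes S :: "'a::euclidean_space set"
  assumes "open S" "S \<noteq> {}"
  shows "emeasure lborel S > 0"
proof (rule ccontr)
  assume "\<not> emeasure lborel S > 0"
  then have "S \<in> null_sets lborel" using assms(1) by (auto simp: null_sets_def)
  then have "negligible S" by (auto simp: negligible_iff_null_sets null_sets_completionI)
  with open_not_negligible[OF assms] show False by contradiction
qed

unbundle cross3_syntax

text \<open>The Gram--Schmidt frame of \<open>(u, v)\<close>. It commutes with left multiplication by rotations, so
  it transports the rotation invariance of Lebesgue measure to the rotation group.\<close>

definition frame :: "(real^3) \<times> (real^3) \<Rightarrow> real^3^3" where
  "frame = (\<lambda>(u, v). let a = u /\<^sub>R norm u; c = (u \<times> v) /\<^sub>R norm (u \<times> v)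
     in transpose (vector [a, c \<times> a, c]))"

text \<open>The unit bounds make the volume finite, so that a uniform distribution exists; linear
  independence makes both norms in \<open>frame\<close> nonzero. Rotations preserve all these
  conditions.\<close>

definition frame_dom :: "((real^3) \<times> (real^3)) set" where
  "frame_dom = {(u, v). norm u < 1 \<and> norm v < 1 \<and> u \<times> v \<noteq> 0}"

lemma frame_SO3:
  assumes "p \<in> frame_dom"
  shows "frame p \<in> SO3"
proof -
  obtain u v where p: "p = (u, v)" by force
  have uv: "u \<noteq> 0" "u \<times> v \<noteq> 0" using assms by (auto simp: p frame_dom_def)
  define a where "a = u /\<^sub>R norm u"
  define c where "c = (u \<times> v) /\<^sub>R norm (u \<times> v)"
  have aa: "a \<bullet> a = 1" and cc: "c \<bullet> c = 1" and ac: "a \<bullet> c = 0"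
    using uv by (auto simp: a_def c_def dot_cross_self dot_square_norm power2_eq_square field_simps)
  have ca: "c \<bullet> a = 0" using ac by (simp add: inner_commute)
  have bb: "(c \<times> a) \<bullet> (c \<times> a) = 1"
    using norm_cross_dot[of c a] aa cc ca by (simp add: power2_norm_eq_inner power_mult_distrib)
  let ?F = "vector [a, c \<times> a, c] :: real^3^3"
  have row: "row 1 ?F = a" "row 2 ?F = c \<times> a" "row 3 ?F = c"
    by (simp_all add: row_def vec_eq_iff)
  have "orthogonal_matrix ?F"
    unfolding orthogonal_matrix_orthonormal_rows
    using aa bb cc ac ca
    by (auto simp: forall_3 row norm_eq_1 orthogonal_def dot_cross_self inner_commute)
  moreover have "det ?F = 1"
  proof -
    \<comment> \<open>The determinant is a scalar triple product; placing
      \<open>c \<times> a\<close> between \<open>a\<close> and \<open>c\<close> gives it the sign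
      \<open>+1\<close>.\<close>
    have "det ?F = a \<bullet> ((c \<times> a) \<times> c)" by (simp add: dot_cross_det)
    also have "\<dots> = (c \<bullet> c) * (a \<bullet> a) - (c \<bullet> a) * (c \<bullet> a)"
      by (simp add: cross3_simps)
    finally show ?thesis using aa cc ca by simp
  qed
  ultimately have "?F \<in> SO3" by (simp add: SO3_def rotation_matrix_def)
  then have "transpose ?F \<in> SO3" by (rule SO3_transpose)
  then show ?thesis by (simp add: p frame_def a_def c_def Let_def)
qed

lemma norm_SO3_mult: "h \<in> SO3 \<Longrightarrow> norm (h *v x) = norm x"
  using orthogonal_transformation_norm[of "\<lambda>x. h *v x"]
  by (simp add: SO3_def rotation_matrix_def orthogonal_transformation_matrix)

lemma cross_SO3_mult: "h \<in> SO3 \<Longrightarrow> (h *v x) \<times> (h *v y) = h *v (x \<times> y)"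
  by (simp add: SO3_def cross_rotation_matrix)

lemma frame_equivariant:
  assumes "h \<in> SO3"
  shows "frame (h *v u, h *v v) = h ** frame (u, v)"
proof -
  have "transpose (vector [h *v x, h *v y, h *v z] :: real^3^3) = h ** transpose (vector [x, y, z] :: real^3^3)" for x y z :: "real^3"
    by (simp add: vec_eq_iff forall_3 transpose_def matrix_matrix_mult_def matrix_vector_mult_def sum_3)
  then show ?thesis
    by (simp add: frame_def Let_def cross_SO3_mult[OF assms] norm_SO3_mult[OF assms]
        matrix_vector_mult_scaleR[symmetric])
qed

lemma frame_dom_equivariant:
  assumes "h \<in> SO3"
  shows "(h *v u, h *v v) \<in> frame_dom \<longleftrightarrow> (u, v) \<in> frame_dom"
  using norm_SO3_mult[OF assms, of "u \<times> v"]
  by (simp add: frame_dom_def cross_SO3_mult[OF assms] norm_SO3_mult[OF assms]) (metis norm_eq_zero norm_SO3_mult[OF assms])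

lemma open_frame_dom: "open frame_dom"
proof -
  have "frame_dom = {p. norm (fst p) < 1} \<inter> {p. norm (snd p) < 1} \<inter> {p. fst p \<times> snd p \<noteq> 0}"
    by (auto simp: frame_dom_def)
  moreover have "open \<dots>"
    by (intro open_Int open_Collect_less open_Collect_neq continuous_intros continuous_on_cross)
  ultimately show ?thesis by simp
qed

lemma continuous_on_frame: "continuous_on frame_dom frame"
proof -
  have "continuous_on S (\<lambda>p. vector [f p, g p, k p] :: real^3^3)"
    if "continuous_on S f" "continuous_on S g" "continuous_on S k"
    for S and f g k :: "(real^3) \<times> (real^3) \<Rightarrow> real^3"
  proof -
    have eq: "(\<lambda>p. vector [f p, g p, k p] :: real^3^3) = (\<lambda>p. \<chi> i. if i = 1 then f p else if i = 2 then g p else k p)"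
      by (auto simp: fun_eq_iff vec_eq_iff forall_3)
    have "continuous_on S (\<lambda>p. if i = 1 then f p else if i = 2 then g p else k p)" for i :: 3
      using that by (cases "i = 1"; cases "i = 2") simp_all
    then show ?thesis unfolding eq by (intro continuous_on_vec_lambda)
  qed
  note vec = this
  have frame_eq: "frame = (\<lambda>p. transpose (vector [fst p /\<^sub>R norm (fst p),
      ((fst p \<times> snd p) /\<^sub>R norm (fst p \<times> snd p)) \<times> (fst p /\<^sub>R norm (fst p)),
      (fst p \<times> snd p) /\<^sub>R norm (fst p \<times> snd p)]))"
    by (auto simp: frame_def Let_def fun_eq_iff)
  show ?thesis unfolding frame_eq
    by (intro continuous_on_transpose vec continuous_on_cross continuous_intros)
       (auto simp: frame_dom_def)
qed

text \<open>A point over the identity shows that the domain is nonempty and that neighbourhoods of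
  the identity have positive measure. The factors \<open>1/2\<close> keep the vectors inside the
  open unit ball.\<close>

lemma frame_one: "(axis 1 (1/2), axis 2 (1/2)) \<in> frame_dom" "frame (axis 1 (1/2), axis 2 (1/2)) = mat 1"
proof -
  have axis_norm: "norm (axis i x :: real^3) = \<bar>x\<bar>" for i x
    proof -
    have "axis i x = (x *\<^sub>R axis i 1 :: real^3)" by (simp add: vec_eq_iff axis_def if_distrib cong: if_cong)
    then show ?thesis by simp
  qed
  have c: "axis 1 (1/2) \<times> axis 2 (1/2) = axis 3 (1/4 :: real)"
    by (simp add: vec_eq_iff forall_3 cross3_def axis_def)
  show "(axis 1 (1/2), axis 2 (1/2)) \<in> frame_dom"
    by (simp add: frame_dom_def c axis_eq_0_iff axis_norm)
  show "frame (axis 1 (1/2), axis 2 (1/2)) = mat 1"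
    by (simp add: frame_def c Let_def axis_norm)
       (simp add: vec_eq_iff forall_3 cross3_def axis_def transpose_def mat_def)
qed

unbundle no cross3_syntax

section \<open>The invariant measure as a pushforward\<close>

abbreviation SO3_borel :: "(real^3^3) measure" where
  "SO3_borel \<equiv> restrict_space borel SO3"

text \<open>The uniform distribution on pairs of vectors, transported by Gram-Schmidt. The value
  \<open>mat 1\<close> off \<open>frame_dom\<close> concerns a null set and makes the map take
  values in \<open>SO3\<close> everywhere.\<close>

definition haar :: "(real^3^3) measure" where
  "haar = distr (uniform_measure lborel frame_dom) SO3_borel (\<lambda>p. if p \<in> frame_dom then frame p else mat 1)"

lemma sets_haar [measurable_cong]: "sets haar = sets SO3_borel"
  by (simp add: haar_def)

lemma space_haar: "space haar = SO3"
  by (simp add: haar_def space_restrict_space)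

lemma emeasure_frame_dom: "emeasure lborel frame_dom \<noteq> 0" "emeasure lborel frame_dom \<noteq> \<infinity>"
proof -
  show "emeasure lborel frame_dom \<noteq> 0"
    using emeasure_lborel_open_pos[OF open_frame_dom] frame_one(1) by fastforce
  have "bounded frame_dom"
    by (rule bounded_subset[of "cball 0 1 \<times> cball 0 1"])
       (auto simp: frame_dom_def intro!: bounded_Times)
  then show "emeasure lborel frame_dom \<noteq> \<infinity>"
    using emeasure_bounded_finite by (auto simp: less_top)
qed

lemma frame_measurable:
  "(\<lambda>p. if p \<in> frame_dom then frame p else mat 1) \<in> uniform_measure lborel frame_dom \<rightarrow>\<^sub>M SO3_borel"
proof (rule measurable_restrict_space2)
  show "(\<lambda>p. if p \<in> frame_dom then frame p else mat 1) \<in> space (uniform_measure lborel frame_dom) \<rightarrow> SO3"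
    by (auto simp: frame_SO3 SO3_one)
  show "(\<lambda>p. if p \<in> frame_dom then frame p else mat 1) \<in> borel_measurable (uniform_measure lborel frame_dom)"
    using borel_measurable_continuous_on_if[OF _ continuous_on_frame, of "\<lambda>_. mat 1"] open_frame_dom
    by (simp add: measurable_cong_sets[OF sets_uniform_measure refl])
qed

lemma prob_space_haar: "prob_space haar"
  unfolding haar_def
  by (intro prob_space.prob_space_distr prob_space_uniform_measure emeasure_frame_dom frame_measurable)

text \<open>Multiplying the frame by \<open>h\<close> amounts to rotating both vectors. That map,
  \<open>?T\<close>, preserves Lebesgue measure on pairs and the set \<open>frame_dom\<close>, hence
  the uniform distribution.\<close>

lemma haar_left_invariant:
  fixes f :: "real^3^3 \<Rightarrow> 'b::{banach, second_countable_topology}"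
  assumes h: "h \<in> SO3" and f: "f \<in> borel_measurable SO3_borel"
  shows "(\<integral>w. f (h ** w) \<partial>haar) = (\<integral>w. f w \<partial>haar)"
proof -
  let ?P = "lborel :: ((real^3) \<times> (real^3)) measure"
  let ?U = "uniform_measure ?P frame_dom"
  let ?q = "\<lambda>p. if p \<in> frame_dom then frame p else mat 1"
  let ?T = "\<lambda>(u, v). (h *v u, h *v v)"
  have oh: "orthogonal_matrix h" using h by (simp add: SO3_def rotation_matrix_def)
  have hm: "(\<lambda>v. h *v v) \<in> borel_measurable lborel"
    by (simp, intro borel_measurable_continuous_onI continuous_intros)
  have Tm: "?T \<in> borel \<rightarrow>\<^sub>M borel"
    by (intro borel_measurable_continuous_onI) (auto simp: case_prod_beta intro!: continuous_intros)
  have "distr lborel borel (\<lambda>v. h *v v) \<Otimes>\<^sub>M distr lborel borel (\<lambda>v. h *v v)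
      = distr (lborel \<Otimes>\<^sub>M lborel) (borel \<Otimes>\<^sub>M borel) ?T"
    by (rule pair_measure_distr[OF hm hm])
       (simp add: lborel_distr_orthogonal_matrix[OF oh] sigma_finite_lborel)
  then have P: "distr ?P borel ?T = ?P"
    by (simp add: lborel_distr_orthogonal_matrix[OF oh] lborel_prod borel_prod)
  have U: "distr ?U borel ?T = ?U"
  proof (rule measure_eqI)
    fix X assume "X \<in> sets (distr ?U borel ?T)"
    then have X: "X \<in> sets borel" by simp
    have D: "frame_dom \<in> sets borel" using open_frame_dom by auto
    have TX: "?T -` X \<in> sets borel" using measurable_sets[OF Tm X] by simp
    have "frame_dom \<inter> ?T -` X = ?T -` (frame_dom \<inter> X)"
      using frame_dom_equivariant[OF h] by auto
    then have "emeasure ?P (frame_dom \<inter> ?T -` X) = emeasure (distr ?P borel ?T) (frame_dom \<inter> X)"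
      using Tm X D by (simp add: emeasure_distr)
    also have "\<dots> = emeasure ?P (frame_dom \<inter> X)" by (simp only: P)
    finally show "emeasure (distr ?U borel ?T) X = emeasure ?U X"
      using Tm X D TX by (simp add: emeasure_distr measurable_cong_sets[OF sets_uniform_measure refl])
  qed simp
  have hw: "(\<lambda>w. h ** w) \<in> SO3_borel \<rightarrow>\<^sub>M SO3_borel"
    using SO3_mult[OF h]
    by (intro measurable_restrict_space2 borel_measurable_continuous_on_restrict continuous_intros)
       (auto simp: space_restrict_space)
  have fh: "(\<lambda>w. f (h ** w)) \<in> borel_measurable SO3_borel"
    using measurable_compose[OF hw f] .
  have "(\<integral>w. f (h ** w) \<partial>haar) = (\<integral>p. f (h ** ?q p) \<partial>?U)"
    unfolding haar_def by (rule integral_distr[OF frame_measurable fh])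
  also have "\<dots> = (\<integral>p. f (?q (?T p)) \<partial>?U)"
  proof (rule integral_cong_AE)
    show "(\<lambda>p. f (h ** ?q p)) \<in> borel_measurable ?U"
      by (rule measurable_compose[OF frame_measurable fh])
    show "(\<lambda>p. f (?q (?T p))) \<in> borel_measurable ?U"
      using measurable_compose[OF Tm] measurable_compose[OF frame_measurable f]
      by (simp add: measurable_cong_sets[OF sets_uniform_measure refl])
    show "AE p in ?U. f (h ** ?q p) = f (?q (?T p))"
      using open_frame_dom frame_dom_equivariant[OF h] frame_equivariant[OF h]
      by (intro AE_uniform_measureI) auto
  qed
  also have "\<dots> = (\<integral>p. f (?q p) \<partial>distr ?U borel ?T)"
    using measurable_compose[OF frame_measurable f] Tm
    by (intro integral_distr[symmetric]) (simp_all add: measurable_cong_sets[OF sets_uniform_measure refl])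
  also have "\<dots> = (\<integral>w. f w \<partial>haar)"
    unfolding U haar_def by (rule integral_distr[OF frame_measurable f, symmetric])
  finally show ?thesis .
qed

text \<open>The frame map is continuous on an open domain and attains the identity, so the preimage
  of \<open>V\<close> is open and nonempty and has positive volume.\<close>

lemma haar_nhd_pos:
  assumes "open V" "mat 1 \<in> V"
  shows "measure haar (V \<inter> SO3) > 0"
proof -
  interpret prob_space haar by (rule prob_space_haar)
  let ?q = "\<lambda>p. if p \<in> frame_dom then frame p else mat 1"
  have VS: "V \<inter> SO3 \<in> sets SO3_borel"
    unfolding sets_restrict_space using assms(1) by (intro image_eqI[of _ _ V]) auto
  have op: "open (frame_dom \<inter> frame -` V)"
    by (rule continuous_open_preimage[OF continuous_on_frame open_frame_dom assms(1)])
  have ne: "frame_dom \<inter> frame -` V \<noteq> {}" using frame_one assms(2) by auto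
  have "emeasure haar (V \<inter> SO3) = emeasure (uniform_measure lborel frame_dom) (?q -` (V \<inter> SO3))"
    unfolding haar_def by (subst emeasure_distr[OF frame_measurable VS]) simp
  also have "\<dots> = emeasure lborel (frame_dom \<inter> ?q -` (V \<inter> SO3)) / emeasure lborel frame_dom"
    using open_frame_dom measurable_sets[OF frame_measurable VS] by (subst emeasure_uniform_measure) auto
  also have "frame_dom \<inter> ?q -` (V \<inter> SO3) = frame_dom \<inter> frame -` V"
    using frame_SO3 by auto
  finally have "emeasure haar (V \<inter> SO3) = emeasure lborel (frame_dom \<inter> frame -` V) / emeasure lborel frame_dom" .
  moreover have "\<dots> \<noteq> 0"
    using emeasure_lborel_open_pos[OF op ne] emeasure_frame_dom by (simp add: ennreal_divide_eq_0_iff)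
  ultimately have "measure haar (V \<inter> SO3) \<noteq> 0"
    by (metis emeasure_eq_measure ennreal_0)
  then show ?thesis by (simp add: zero_less_measure_iff)
qed

section \<open>Schur orthogonality\<close>

lemma finite_degs [simp]: "finite (degs l)"
  by (simp add: degs_def)

lemma zero_in_degs [simp]: "0 \<in> degs l"
  by (simp add: degs_def)

lemma card_degs: "card (degs l) = 2 * l + 1"
  by (simp add: degs_def)

lemma rot_z_0: "rot_z 0 = mat 1"
  by (simp add: rot_z_def vec_eq_iff forall_3 mat_def)

lemma canonical_repD:
  assumes "canonical_rep l D"
  shows "m \<notin> degs l \<or> n \<notin> degs l \<Longrightarrow> D g m n = 0"
    and "g \<in> SO3 \<Longrightarrow> h \<in> SO3 \<Longrightarrow> D (g ** h) m n = (\<Sum>s\<in>degs l. D g m s * D h s n)"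
    and "g \<in> SO3 \<Longrightarrow> m \<in> degs l \<Longrightarrow> n \<in> degs l \<Longrightarrow>
      (\<Sum>s\<in>degs l. D g m s * cnj (D g n s)) = of_bool (m = n)"
    and "continuous_on SO3 (\<lambda>g. D g m n)"
    and "rep_irreducible l D"
    and "m \<in> degs l \<Longrightarrow> n \<in> degs l \<Longrightarrow>
      D (rot_z \<alpha>) m n = (if m = n then cis (- (of_int n * \<alpha>)) else 0)"
  using assms unfolding canonical_rep_def by blast+

lemma canonical_rep_one:
  assumes "canonical_rep l D" "m \<in> degs l" "n \<in> degs l"
  shows "D (mat 1) m n = of_bool (m = n)"
  using canonical_repD(6)[OF assms, of 0] by (simp add: rot_z_0)

lemma canonical_rep_transpose:
  assumes D: "canonical_rep l D" and g: "g \<in> SO3"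
  shows "D (transpose g) m n = cnj (D g n m)"
proof (cases "m \<in> degs l \<and> n \<in> degs l")
  case True
  have "(\<Sum>s\<in>degs l. \<Sum>t\<in>degs l. D (transpose g) m s * D g s t * cnj (D g n t))
      = (\<Sum>s\<in>degs l. D (transpose g) m s * of_bool (s = n))"
    using canonical_repD(3)[OF D g] True
    by (intro sum.cong refl) (simp add: mult.assoc flip: sum_distrib_left)
  also have "\<dots> = D (transpose g) m n" using True by (simp add: of_bool_def if_distrib cong: if_cong)
  finally have "D (transpose g) m n = (\<Sum>t\<in>degs l. (\<Sum>s\<in>degs l. D (transpose g) m s * D g s t) * cnj (D g n t))"
    by (subst (asm) sum.swap) (simp add: sum_distrib_right)
  also have "\<dots> = (\<Sum>t\<in>degs l. D (mat 1) m t * cnj (D g n t))"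
    using canonical_repD(2)[OF D SO3_transpose[OF g] g] by (simp add: SO3_transpose_mult[OF g])
  also have "\<dots> = (\<Sum>t\<in>degs l. if t = m then cnj (D g n m) else 0)"
    using canonical_rep_one[OF D] True by (intro sum.cong refl) auto
  also have "\<dots> = cnj (D g n m)" using True by simp
  finally show ?thesis .
qed (use canonical_repD(1)[OF D] in auto)

lemma canonical_rep_row_norm:
  assumes "canonical_rep l D" "g \<in> SO3" "m \<in> degs l"
  shows "(\<Sum>s\<in>degs l. (cmod (D g m s))\<^sup>2) = 1"
proof -
  have "complex_of_real (\<Sum>s\<in>degs l. (cmod (D g m s))\<^sup>2) = 1"
    using canonical_repD(3)[OF assms(1,2,3,3)] by (simp add: complex_norm_square del: of_real_power)
  then show ?thesis by (simp only: of_real_eq_1_iff)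
qed

lemma canonical_rep_norm_le_one:
  assumes "canonical_rep l D" "g \<in> SO3"
  shows "cmod (D g m n) \<le> 1"
proof (cases "m \<in> degs l \<and> n \<in> degs l")
  case True
  then have "(cmod (D g m n))\<^sup>2 \<le> (\<Sum>s\<in>degs l. (cmod (D g m s))\<^sup>2)"
    by (intro member_le_sum) auto
  also have "\<dots> = 1" using canonical_rep_row_norm[OF assms] True by blast
  finally show ?thesis by (simp add: abs_square_le_1)
qed (use canonical_repD(1)[OF assms(1)] in auto)

lemmas haar_integrable = integrable_continuous_on_compact[OF prob_space_haar sets_haar compact_SO3]

lemma haar_integral_cong:
  "(\<And>g. g \<in> SO3 \<Longrightarrow> f g = f' g) \<Longrightarrow> (\<integral>g. f g \<partial>haar) = (\<integral>g. f' g \<partial>haar)"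
  by (rule Bochner_Integration.integral_cong) (auto simp: space_haar)

lemma haar_integral_translate:
  fixes f :: "real^3^3 \<Rightarrow> 'b::{banach, second_countable_topology}"
  assumes "h \<in> SO3" "continuous_on SO3 f"
  shows "(\<integral>w. f (h ** w) \<partial>haar) = (\<integral>w. f w \<partial>haar)"
  by (rule haar_left_invariant[OF assms(1) borel_measurable_continuous_on_restrict[OF assms(2)]])

lemma continuous_on_SO3_compose:
  assumes "continuous_on SO3 f" "continuous_on SO3 k" "\<And>g. g \<in> SO3 \<Longrightarrow> k g \<in> SO3"
  shows "continuous_on SO3 (\<lambda>g. f (k g))"
  using assms by (intro continuous_on_compose2[OF assms(1,2)]) auto

section \<open>Schur's lemma for diagonal intertwiners\<close>

text \<open>The kernel of the diagonal matrix \<open>d\<close> is invariant under \<open>D\<close>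
  and contains the \<open>k\<close>-th basis vector, so by irreducibility it is the whole space. The
  family \<open>E\<close> is arbitrary; it may thus be a representation of smaller weight, extended
  by zero.\<close>

lemma rep_irreducible_diagonal:
  assumes irr: "rep_irreducible l D"
    and rel: "\<And>g m n. g \<in> SO3 \<Longrightarrow> m \<in> degs l \<Longrightarrow> n \<in> degs l \<Longrightarrow> d m * D g m n = E g m n * d n"
    and supp: "\<And>g m n. m \<notin> degs l \<Longrightarrow> D g m n = 0"
    and k: "k \<in> degs l" "d k = 0" and n: "n \<in> degs l"
  shows "d n = 0"
proof -
  let ?V = "{v :: int \<Rightarrow> complex. \<forall>n. n \<notin> degs l \<longrightarrow> v n = 0}"
  define W where "W = {v \<in> ?V. \<forall>m\<in>degs l. d m * v m = 0}"
  have inv: "(\<lambda>m. \<Sum>n\<in>degs l. D g m n * v n) \<in> W" if g: "g \<in> SO3" and v: "v \<in> W" for g v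
  proof -
    have "d m * (\<Sum>n\<in>degs l. D g m n * v n) = 0" if m: "m \<in> degs l" for m
    proof -
      have "d m * (\<Sum>n\<in>degs l. D g m n * v n) = (\<Sum>n\<in>degs l. (d m * D g m n) * v n)"
        by (simp add: sum_distrib_left mult.assoc)
      also have "\<dots> = (\<Sum>n\<in>degs l. E g m n * (d n * v n))"
        using rel[OF g m] by (intro sum.cong refl) (simp add: mult.assoc)
      also have "\<dots> = 0" using v by (intro sum.neutral) (auto simp: W_def)
      finally show ?thesis .
    qed
    then show ?thesis using supp by (auto simp: W_def)
  qed
  have "W = {\<lambda>_. 0} \<or> W = ?V"
  proof (rule irr[unfolded rep_irreducible_def, THEN spec, of W, THEN mp, THEN mp])
    show "W \<subseteq> ?V" by (auto simp: W_def)
    have "(\<lambda>_. 0) \<in> W" by (simp add: W_def)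
    moreover have "(\<lambda>n. v n + w n) \<in> W" if "v \<in> W" "w \<in> W" for v w
      using that by (fastforce simp: W_def distrib_left)
    moreover have "(\<lambda>n. c * v n) \<in> W" if "v \<in> W" for c v
      using that by (auto simp: W_def)
    ultimately show "(\<lambda>_. 0) \<in> W \<and> (\<forall>v\<in>W. \<forall>w\<in>W. (\<lambda>n. v n + w n) \<in> W) \<and>
        (\<forall>c. \<forall>v\<in>W. (\<lambda>n. c * v n) \<in> W) \<and>
        (\<forall>g\<in>SO3. \<forall>v\<in>W. (\<lambda>m. \<Sum>n\<in>degs l. D g m n * v n) \<in> W)"
      using inv by blast
  qed
  moreover have "(\<lambda>m. of_bool (m = k)) \<in> W" using k by (auto simp: W_def)
  moreover have "(\<lambda>m. of_bool (m = k)) \<noteq> (\<lambda>_. 0 :: complex)"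
    by (auto dest: fun_cong[of _ _ k])
  ultimately have "W = ?V" by auto
  then have "(\<lambda>m. of_bool (m = n)) \<in> W" using n by auto
  then show ?thesis using n by (auto simp: W_def)
qed

text \<open>An intertwiner respects the eigenspaces of the rotations about the z axis, and different
  labels belong to different eigenvalues.\<close>

lemma intertwiner_diagonal:
  assumes D: "canonical_rep l D" and D': "canonical_rep l' D'"
    and C: "\<And>g m n. g \<in> SO3 \<Longrightarrow> m \<in> degs l \<Longrightarrow> n \<in> degs l' \<Longrightarrow>
      (\<Sum>s\<in>degs l. D g m s * C s n) = (\<Sum>s\<in>degs l'. C m s * D' g s n)"
    and mn: "m \<in> degs l" "n \<in> degs l'" "m \<noteq> n"
  shows "C m n = 0"
proof -
  \<comment> \<open>At this angle the two eigenvalues differ by the factor \<open>-1\<close>, so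
    that the entry equals its own negative.\<close>
  define \<alpha> where "\<alpha> = pi / of_int (m - n)"
  have "(\<Sum>s\<in>degs l. D (rot_z \<alpha>) m s * C s n) = (\<Sum>s\<in>degs l. if s = m then cis (- (of_int m * \<alpha>)) * C m n else 0)"
    using canonical_repD(6)[OF D mn(1)] by (intro sum.cong refl) auto
  moreover have "(\<Sum>s\<in>degs l'. C m s * D' (rot_z \<alpha>) s n) = (\<Sum>s\<in>degs l'. if s = n then C m n * cis (- (of_int n * \<alpha>)) else 0)"
    using canonical_repD(6)[OF D' _ mn(2)] by (intro sum.cong refl) auto
  ultimately have "cis (- (of_int m * \<alpha>)) * C m n = C m n * cis (- (of_int n * \<alpha>))"
    using C[OF rot_z_SO3 mn(1,2), of \<alpha>] mn by auto
  then have "cis (of_int m * \<alpha>) * (cis (- (of_int m * \<alpha>)) * C m n) = cis (of_int m * \<alpha>) * (C m n * cis (- (of_int n * \<alpha>)))"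
    by simp
  then have "C m n = cis (of_int m * \<alpha> - of_int n * \<alpha>) * C m n"
    by (simp add: mult_ac cis_mult flip: mult.assoc)
  also have "of_int m * \<alpha> - of_int n * \<alpha> = pi"
    using mn(3) by (simp add: \<alpha>_def flip: left_diff_distrib diff_divide_distrib of_int_diff)
  finally show ?thesis by simp
qed

text \<open>The diagonal of \<open>C\<close>, extended by zero to the larger label set, vanishes at
  the label \<open>int l'\<close>. Irreducibility of the larger representation spreads this zero to
  all labels.\<close>

lemma intertwiner_distinct:
  assumes D: "canonical_rep l D" and D': "canonical_rep l' D'" and "l < l'"
    and C: "\<And>g m n. g \<in> SO3 \<Longrightarrow> m \<in> degs l \<Longrightarrow> n \<in> degs l' \<Longrightarrow>
      (\<Sum>s\<in>degs l. D g m s * C s n) = (\<Sum>s\<in>degs l'. C m s * D' g s n)"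
    and mn: "m \<in> degs l" "n \<in> degs l'"
  shows "C m n = 0"
proof (cases "m = n")
  case True
  have sub: "degs l \<subseteq> degs l'" using \<open>l < l'\<close> by (auto simp: degs_def)
  define c where "c m = (if m \<in> degs l then C m m else 0)" for m
  have "c m * D' g m n = D g m n * c n" if "g \<in> SO3" "m \<in> degs l'" "n \<in> degs l'" for g m n
  proof (cases "m \<in> degs l")
    case True
    have "(\<Sum>s\<in>degs l'. C m s * D' g s n) = (\<Sum>s\<in>degs l'. if s = m then C m m * D' g m n else 0)"
      using intertwiner_diagonal[OF D D' C True] by (intro sum.cong refl) auto
    moreover have "(\<Sum>s\<in>degs l. D g m s * C s n) = (\<Sum>s\<in>degs l. if s = n then D g m n * C n n else 0)"
      using intertwiner_diagonal[OF D D' C] that by (intro sum.cong refl) auto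
    ultimately show ?thesis using C[OF that(1) True that(3)] True sub by (auto simp: c_def split: if_splits)
  qed (use canonical_repD(1)[OF D] in \<open>auto simp: c_def\<close>)
  then have "c m = 0"
    by (rule rep_irreducible_diagonal[OF canonical_repD(5)[OF D'] _ canonical_repD(1)[OF D'], where k = "int l'"])
       (use mn sub \<open>l < l'\<close> in \<open>auto simp: c_def degs_def\<close>)
  with True mn show ?thesis by (simp add: c_def)
qed (use intertwiner_diagonal[OF D D' C mn] in blast)

text \<open>Subtracting the multiple \<open>C 0 0\<close> of the identity leaves an intertwiner that
  vanishes at one label. The label \<open>0\<close> occurs in every weight.\<close>

lemma intertwiner_scalar:
  assumes D: "canonical_rep l D"
    and C: "\<And>g m n. g \<in> SO3 \<Longrightarrow> m \<in> degs l \<Longrightarrow> n \<in> degs l \<Longrightarrow>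
      (\<Sum>s\<in>degs l. D g m s * C s n) = (\<Sum>s\<in>degs l. C m s * D g s n)"
    and m: "m \<in> degs l"
  shows "C m m = C 0 0"
proof -
  have "(C m m - C 0 0) * D g m n = D g m n * (C n n - C 0 0)"
    if "g \<in> SO3" "m \<in> degs l" "n \<in> degs l" for g m n
  proof -
    have "(\<Sum>s\<in>degs l. C m s * D g s n) = (\<Sum>s\<in>degs l. if s = m then C m m * D g m n else 0)"
      using intertwiner_diagonal[OF D D C that(2)] by (intro sum.cong refl) auto
    moreover have "(\<Sum>s\<in>degs l. D g m s * C s n) = (\<Sum>s\<in>degs l. if s = n then D g m n * C n n else 0)"
      using intertwiner_diagonal[OF D D C] that by (intro sum.cong refl) auto
    ultimately show ?thesis using C[OF that] that by (auto simp: algebra_simps)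
  qed
  then have "C m m - C 0 0 = 0"
    by (rule rep_irreducible_diagonal[OF canonical_repD(5)[OF D] _ canonical_repD(1)[OF D], where k = 0 and d = "\<lambda>m. C m m - C 0 0"])
       (use m in auto)
  then show ?thesis by simp
qed

section \<open>Orthogonality of matrix entries\<close>

lemma canonical_rep_integrable:
  assumes "canonical_rep l D" "canonical_rep l' D'"
  shows "integrable haar (\<lambda>g. D g m a * cnj (D' g n b))"
  by (intro haar_integrable continuous_intros canonical_repD(4)[OF assms(1)] canonical_repD(4)[OF assms(2)])

text \<open>Averages over the group intertwine: invariance moves the factor \<open>h\<close> from
  one representation to the other. Only rows are transformed, so the column labels \<open>a\<close>
  and \<open>b\<close> stay free parameters.\<close>

lemma haar_intertwiner:
  fixes a b :: int
  assumes D: "canonical_rep l D" and D': "canonical_rep l' D'"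
    and h: "h \<in> SO3"
  defines "C \<equiv> \<lambda>m n. \<integral>g. D g m a * cnj (D' g n b) \<partial>haar"
  shows "(\<Sum>s\<in>degs l. D h m s * C s n) = (\<Sum>s\<in>degs l'. C m s * D' h s n)"
proof -
  note int = canonical_rep_integrable[OF D D']
  have "(\<Sum>s\<in>degs l. D h m s * C s n) = (\<integral>g. (\<Sum>s\<in>degs l. D h m s * (D g s a * cnj (D' g n b))) \<partial>haar)"
    unfolding C_def using int by (simp add: integrable_mult_right)
  \<comment> \<open>Inserting \<open>transpose h ** h\<close> makes the integrand a function of
    \<open>h ** g\<close>, ready for translation.\<close>
  also have "\<dots> = (\<integral>g. D (h ** g) m a * cnj (D' (transpose h ** (h ** g)) n b) \<partial>haar)"
    using canonical_repD(2)[OF D h]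
    by (intro haar_integral_cong)
       (simp add: matrix_mul_assoc SO3_transpose_mult[OF h] sum_distrib_right mult.assoc)
  also have "\<dots> = (\<integral>g. D g m a * cnj (D' (transpose h ** g) n b) \<partial>haar)"
    by (rule haar_integral_translate[OF h, where f = "\<lambda>g. D g m a * cnj (D' (transpose h ** g) n b)"])
       (intro continuous_intros canonical_repD(4)[OF D] continuous_on_SO3_compose[OF canonical_repD(4)[OF D']]
          SO3_mult SO3_transpose[OF h])
  also have "\<dots> = (\<integral>g. (\<Sum>s\<in>degs l'. (D g m a * cnj (D' g s b)) * D' h s n) \<partial>haar)"
    using canonical_repD(2)[OF D' SO3_transpose[OF h]]
    by (intro haar_integral_cong)
       (simp add: canonical_rep_transpose[OF D' h] sum_distrib_left mult_ac)
  also have "\<dots> = (\<Sum>s\<in>degs l'. C m s * D' h s n)"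
    unfolding C_def using int by (simp add: integrable_mult_left)
  finally show ?thesis .
qed

lemma schur_orthogonality_row:
  assumes D: "canonical_rep l D" and D': "canonical_rep l' D'"
    and mn: "m \<in> degs l" "n \<in> degs l'" "m \<noteq> n"
  shows "(\<integral>g. D g m a * cnj (D' g n b) \<partial>haar) = 0"
  by (rule intertwiner_diagonal[OF D D' haar_intertwiner[OF D D'] mn])

lemma schur_orthogonality_weight:
  assumes D: "canonical_rep l D" and D': "canonical_rep l' D'" and "l \<noteq> l'"
    and mn: "m \<in> degs l" "n \<in> degs l'"
  shows "(\<integral>g. D g m a * cnj (D' g n b) \<partial>haar) = 0"
proof (cases "l < l'")
  case True
  then show ?thesis by (rule intertwiner_distinct[OF D D' _ haar_intertwiner[OF D D'] mn])
next
  case False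
  then have "(\<integral>g. D' g n b * cnj (D g m a) \<partial>haar) = 0"
    using \<open>l \<noteq> l'\<close> by (intro intertwiner_distinct[OF D' D _ haar_intertwiner[OF D' D] mn(2,1)]) auto
  then have "cnj (\<integral>g. D' g n b * cnj (D g m a) \<partial>haar) = 0" by simp
  then show ?thesis by (simp flip: Bochner_Integration.integral_cnj add: mult.commute)
qed

text \<open>By Schur's lemma the integral is the same in every row. The \<open>2 * l + 1\<close>
  rows together give the squared norm of a column of a unitary matrix.\<close>

lemma schur_orthogonality_norm:
  assumes D: "canonical_rep l D" and ma: "m \<in> degs l" "a \<in> degs l"
  shows "(\<integral>g. D g m a * cnj (D g m a) \<partial>haar) = 1 / of_nat (2 * l + 1)"
proof -
  interpret prob_space haar by (rule prob_space_haar)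
  let ?C = "\<lambda>m. \<integral>g. D g m a * cnj (D g m a) \<partial>haar"
  have const: "?C s = ?C m" if "s \<in> degs l" for s
    using intertwiner_scalar[OF D haar_intertwiner[OF D D] that, of a a]
      intertwiner_scalar[OF D haar_intertwiner[OF D D] ma(1), of a a] by simp
  have "of_nat (2 * l + 1) * ?C m = (\<Sum>s\<in>degs l. ?C m)" by (simp add: card_degs)
  also have "\<dots> = (\<Sum>s\<in>degs l. ?C s)" using const by (intro sum.cong refl) auto
  also have "\<dots> = (\<integral>g. (\<Sum>s\<in>degs l. D g s a * cnj (D g s a)) \<partial>haar)"
    using canonical_rep_integrable[OF D D] by simp
  also have "\<dots> = (\<integral>g. 1 \<partial>haar)"
  proof (rule haar_integral_cong)
    fix g assume g: "g \<in> SO3"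
    have "(\<Sum>s\<in>degs l. D g s a * cnj (D g s a)) = D (transpose g ** g) a a"
      using canonical_repD(2)[OF D SO3_transpose[OF g] g]
      by (simp add: canonical_rep_transpose[OF D g] mult.commute)
    then show "(\<Sum>s\<in>degs l. D g s a * cnj (D g s a)) = 1"
      using canonical_rep_one[OF D ma(2,2)] by (simp add: SO3_transpose_mult[OF g])
  qed
  finally have "of_nat (2 * l + 1) * ?C m = 1" by (simp add: prob_space)
  moreover have "of_nat (2 * l + 1) \<noteq> (0 :: complex)" by (metis of_nat_eq_0_iff add_is_0 one_neq_zero)
  ultimately show ?thesis by (simp add: eq_divide_eq mult.commute del: of_nat_add of_nat_mult)
qed

section \<open>Characters and completeness\<close>

text \<open>Euler's rotation theorem: \<open>det (g - mat 1)\<close> equals its own negative,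
  because \<open>g\<close> has determinant one and the dimension is odd.\<close>

lemma SO3_fixed_vector:
  assumes g: "g \<in> SO3"
  obtains v where "norm v = 1" "g *v v = v"
proof -
  have "g ** (mat 1 - transpose g) = g - mat 1"
    using SO3_transpose_mult(2)[OF g]
    by (simp add: vec_eq_iff forall_3 matrix_matrix_mult_def transpose_def sum_3 mat_def right_diff_distrib')
  then have "det (g - mat 1) = det g * det (mat 1 - transpose g)"
    by (metis det_mul)
  also have "mat 1 - transpose g = transpose (mat 1 - g)"
    by (simp add: transpose_def vec_eq_iff mat_def)
  also have "det g = 1" using g by (simp add: SO3_def rotation_matrix_def)
  also have "det (transpose (mat 1 - g)) = det (mat 1 - g)" by (rule det_transpose)
  also have "det (mat 1 - g) = - det (g - mat 1)"
    by (simp add: det_3 algebra_simps)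
  finally have "det (g - mat 1) = 0" by simp
  then have "\<not> invertible (g - mat 1)" by (simp add: invertible_det_nz)
  then obtain x where x: "(g - mat 1) *v x = 0" "x \<noteq> 0"
    by (auto simp: invertible_left_inverse matrix_left_invertible_ker)
  then have "g *v x = x" by (simp add: matrix_vector_mult_diff_rdistrib)
  with x(2) that[of "x /\<^sub>R norm x"] show thesis
    by (simp add: matrix_vector_mult_scaleR)
qed

text \<open>The third column is that of the identity; the unit length of the third row makes its
  other entries vanish, and the remaining block is a rotation of the plane.\<close>

lemma SO3_fix_axis_rot_z:
  assumes g: "g \<in> SO3" and ax: "g *v axis 3 1 = axis 3 1"
  obtains \<alpha> where "g = rot_z \<alpha>"
proof -
  have c3: "g $ 1 $ 3 = 0" "g $ 2 $ 3 = 0" "g $ 3 $ 3 = 1"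
    using ax by (auto simp: vec_eq_iff forall_3 matrix_vector_mult_def sum_3 axis_def)
  have o: "transpose g ** g = mat 1" "g ** transpose g = mat 1" using SO3_transpose_mult[OF g] .
  have r3: "g $ 3 $ 1 * g $ 3 $ 1 + g $ 3 $ 2 * g $ 3 $ 2 = 0"
    using o(2) c3 by (simp add: vec_eq_iff forall_3 matrix_matrix_mult_def transpose_def sum_3 mat_def)
  then have r3: "g $ 3 $ 1 = 0" "g $ 3 $ 2 = 0"
    by (simp_all add: sum_squares_eq_zero_iff)
  have e: "g $ 1 $ 1 * g $ 1 $ 1 + g $ 2 $ 1 * g $ 2 $ 1 = 1"
      "g $ 1 $ 1 * g $ 1 $ 2 + g $ 2 $ 1 * g $ 2 $ 2 = 0"
      "g $ 1 $ 2 * g $ 1 $ 2 + g $ 2 $ 2 * g $ 2 $ 2 = 1"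
    using o(1) c3 r3 by (simp_all add: vec_eq_iff forall_3 matrix_matrix_mult_def transpose_def sum_3 mat_def)
  have d: "g $ 1 $ 1 * g $ 2 $ 2 - g $ 1 $ 2 * g $ 2 $ 1 = 1"
    using g c3 r3 by (simp add: SO3_def rotation_matrix_def det_3)
  \<comment> \<open>Multiplying by the squared length of the first column, which is
    \<open>1\<close>, lets the determinant and the orthogonality of the columns enter.\<close>
  have "g $ 2 $ 2 = (g $ 1 $ 1 * g $ 1 $ 1 + g $ 2 $ 1 * g $ 2 $ 1) * g $ 2 $ 2" using e by simp
  also have "\<dots> = g $ 1 $ 1 * (g $ 1 $ 1 * g $ 2 $ 2 - g $ 1 $ 2 * g $ 2 $ 1)
      + g $ 2 $ 1 * (g $ 1 $ 1 * g $ 1 $ 2 + g $ 2 $ 1 * g $ 2 $ 2)" by (simp add: algebra_simps)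
  finally have d22: "g $ 2 $ 2 = g $ 1 $ 1" using d e by simp
  have "g $ 1 $ 2 = (g $ 1 $ 1 * g $ 1 $ 1 + g $ 2 $ 1 * g $ 2 $ 1) * g $ 1 $ 2" using e by simp
  also have "\<dots> = g $ 1 $ 1 * (g $ 1 $ 1 * g $ 1 $ 2 + g $ 2 $ 1 * g $ 2 $ 2)
      - g $ 2 $ 1 * (g $ 1 $ 1 * g $ 2 $ 2 - g $ 1 $ 2 * g $ 2 $ 1)" by (simp add: algebra_simps)
  finally have d12: "g $ 1 $ 2 = - g $ 2 $ 1" using d e by simp
  have "(g $ 1 $ 1)\<^sup>2 + (g $ 2 $ 1)\<^sup>2 = 1" using e(1) by (simp add: power2_eq_square)
  then obtain \<alpha> where "g $ 1 $ 1 = cos \<alpha>" "g $ 2 $ 1 = sin \<alpha>" by (metis sincos_total_2pi_le)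
  then have "g = rot_z \<alpha>"
    using c3 r3 d12 d22 by (simp add: rot_z_def vec_eq_iff forall_3)
  then show thesis by (rule that)
qed

lemma SO3_conjugate_rot_z:
  assumes g: "g \<in> SO3"
  obtains h \<alpha> where "h \<in> SO3" "g = h ** rot_z \<alpha> ** transpose h"
proof -
  obtain v where v: "norm v = 1" "g *v v = v" by (rule SO3_fixed_vector[OF g])
  obtain h where h: "rotation_matrix h" "h *v axis 3 1 = v"
    using rotation_matrix_exists_basis[of v 3] v(1) by auto
  then have hS: "h \<in> SO3" by (simp add: SO3_def)
  define k where "k = transpose h"
  have k: "k ** h = mat 1" "h ** k = mat 1" using SO3_transpose_mult[OF hS] by (auto simp: k_def)
  have "(k ** g ** h) *v axis 3 1 = k *v (g *v (h *v axis 3 1))"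
    by (simp add: matrix_vector_mul_assoc matrix_mul_assoc)
  also have "\<dots> = k *v (h *v axis 3 1)" using v h by simp
  also have "\<dots> = axis 3 1" by (simp add: matrix_vector_mul_assoc k)
  finally obtain \<alpha> where "k ** g ** h = rot_z \<alpha>"
    using SO3_fix_axis_rot_z[of "k ** g ** h"] SO3_mult g hS SO3_transpose[OF hS] by (metis k_def)
  moreover have "h ** (k ** g ** h) ** k = (h ** k) ** g ** (h ** k)" by (simp add: matrix_mul_assoc)
  ultimately have "g = h ** rot_z \<alpha> ** k" by (simp add: k)
  with hS that show thesis by (simp add: k_def)
qed

section \<open>Characters as functions of the rotation angle\<close>

definition rep_char :: "nat \<Rightarrow> (real^3^3 \<Rightarrow> int \<Rightarrow> int \<Rightarrow> complex) \<Rightarrow> real^3^3 \<Rightarrow> complex" where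
  "rep_char l D g = (\<Sum>m\<in>degs l. D g m m)"

lemma rep_char_conjugate:
  assumes D: "canonical_rep l D" and g: "g \<in> SO3" and h: "h \<in> SO3"
  shows "rep_char l D (h ** g ** transpose h) = rep_char l D g"
proof -
  note [simp] = h g SO3_transpose[OF h] SO3_mult
  have "rep_char l D (h ** (g ** transpose h))
      = (\<Sum>m\<in>degs l. \<Sum>s\<in>degs l. D h m s * D (g ** transpose h) s m)"
    unfolding rep_char_def by (simp add: canonical_repD(2)[OF D])
  also have "\<dots> = (\<Sum>s\<in>degs l. \<Sum>m\<in>degs l. D (g ** transpose h) s m * D h m s)"
    by (subst sum.swap) (simp add: mult.commute)
  also have "\<dots> = (\<Sum>s\<in>degs l. D ((g ** transpose h) ** h) s s)"
    by (intro sum.cong refl canonical_repD(2)[OF D, symmetric]) simp_all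
  also have "(g ** transpose h) ** h = g"
    by (simp add: SO3_transpose_mult[OF h] flip: matrix_mul_assoc)
  finally show ?thesis by (simp add: rep_char_def matrix_mul_assoc)
qed

lemma degs_Suc: "degs (Suc l) = insert (int (Suc l)) (insert (- int (Suc l)) (degs l))"
  by (auto simp: degs_def)

definition dirichlet :: "nat \<Rightarrow> real \<Rightarrow> complex" where
  "dirichlet l \<alpha> = (\<Sum>m\<in>degs l. cis (- (of_int m * \<alpha>)))"

lemma dirichlet_0: "dirichlet 0 \<alpha> = 1"
  by (simp add: dirichlet_def degs_def)

lemma dirichlet_Suc:
  "dirichlet (Suc l) \<alpha> = dirichlet l \<alpha> + 2 * complex_of_real (cos (real (Suc l) * \<alpha>))"
proof -
  have "int (Suc l) \<notin> insert (- int (Suc l)) (degs l)" "- int (Suc l) \<notin> degs l"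
    by (auto simp: degs_def)
  moreover have "cis (- (real l * \<alpha>) - \<alpha>) + cis (\<alpha> + real l * \<alpha>) = 2 * complex_of_real (cos (\<alpha> + real l * \<alpha>))"
    using cos_minus[of "\<alpha> + real l * \<alpha>"] sin_minus[of "\<alpha> + real l * \<alpha>"]
    by (simp add: complex_eq_iff minus_diff_commute)
  ultimately show ?thesis
    unfolding dirichlet_def degs_Suc by (simp add: algebra_simps minus_diff_commute)
qed

text \<open>This is the Clebsch-Gordan rule for the product with the character of weight one,
  \<open>1 + 2 * cos \<alpha>\<close>, after its middle term has been subtracted. It starts at
  weight one, as weight zero has no lower neighbour.\<close>

lemma dirichlet_recurrence:
  "2 * complex_of_real (cos \<alpha>) * dirichlet (Suc l) \<alpha> = dirichlet (Suc (Suc l)) \<alpha> + dirichlet l \<alpha>"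
proof (induction l)
  case 0
  have "cos (2 * \<alpha>) = 2 * (cos \<alpha>)\<^sup>2 - 1" by (rule cos_double_cos)
  then have c2: "complex_of_real (cos (2 * \<alpha>)) = 2 * (complex_of_real (cos \<alpha>))\<^sup>2 - 1" by simp
  show ?case
    by (simp add: dirichlet_Suc dirichlet_0 c2) (simp add: algebra_simps power2_eq_square)
next
  case (Suc l)
  have "cos (real (Suc (Suc (Suc l))) * \<alpha>) + cos (real (Suc l) * \<alpha>) = 2 * cos \<alpha> * cos (real (Suc (Suc l)) * \<alpha>)"
    using cos_add[of "real (Suc (Suc l)) * \<alpha>" \<alpha>] cos_diff[of "real (Suc (Suc l)) * \<alpha>" \<alpha>]
    by (simp add: algebra_simps)
  then have "2 * complex_of_real (cos \<alpha>) * (2 * complex_of_real (cos (real (Suc (Suc l)) * \<alpha>)))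
      = 2 * complex_of_real (cos (real (Suc (Suc (Suc l))) * \<alpha>)) + 2 * complex_of_real (cos (real (Suc l) * \<alpha>))"
    by (metis (no_types, opaque_lifting) distrib_left mult.assoc mult.left_commute of_real_add of_real_mult of_real_numeral)
  then show ?case
    using Suc by (simp only: dirichlet_Suc[of "Suc (Suc l)"] dirichlet_Suc[of "Suc l"] dirichlet_Suc[of l] distrib_left)
      (simp add: algebra_simps)
qed

text \<open>The value at a rotation by the angle \<open>\<alpha>\<close> is \<open>(1 + cos \<alpha>) / 2\<close>.\<close>

definition peak :: "real^3^3 \<Rightarrow> real" where
  "peak g = (trace g + 1) / 4"

lemma peak_conjugate_rot_z:
  assumes "h \<in> SO3"
  shows "peak (h ** rot_z \<alpha> ** transpose h) = (1 + cos \<alpha>) / 2"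
proof -
  have "trace (h ** rot_z \<alpha> ** transpose h) = trace (transpose h ** (h ** rot_z \<alpha>))"
    by (rule trace_mul_sym)
  also have "\<dots> = trace (rot_z \<alpha>)"
    by (simp add: matrix_mul_assoc SO3_transpose_mult[OF assms])
  also have "\<dots> = 1 + 2 * cos \<alpha>" by (simp add: trace_def sum_3 rot_z_def)
  finally show ?thesis by (simp add: peak_def)
qed

lemma peak_bounds:
  assumes "g \<in> SO3"
  shows "0 \<le> peak g" "peak g \<le> 1"
proof -
  obtain h \<alpha> where "h \<in> SO3" "g = h ** rot_z \<alpha> ** transpose h" using SO3_conjugate_rot_z[OF assms] .
  then have p: "peak g = (1 + cos \<alpha>) / 2" using peak_conjugate_rot_z by simp
  show "0 \<le> peak g" using add_left_mono[OF cos_ge_minus_one[of \<alpha>], of 1] unfolding p by simp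
  show "peak g \<le> 1" using add_left_mono[OF cos_le_one[of \<alpha>], of 1] unfolding p by simp
qed

lemma rep_char_conjugate_rot_z:
  assumes D: "canonical_rep l D" and h: "h \<in> SO3"
  shows "rep_char l D (h ** rot_z \<alpha> ** transpose h) = dirichlet l \<alpha>"
  unfolding rep_char_conjugate[OF D rot_z_SO3 h]
  by (simp add: rep_char_def dirichlet_def canonical_repD(6)[OF D])

section \<open>Concentration at the identity\<close>

lemma continuous_on_peak: "continuous_on S peak"
  unfolding peak_def trace_def by (intro continuous_intros) auto

text \<open>The link between \<open>peak\<close> and the topology: a value close to \<open>1\<close>
  forces the rotation to be close to the identity.\<close>

lemma norm_diff_one_SO3:
  assumes g: "g \<in> SO3"
  shows "(norm (g - mat 1))\<^sup>2 = 8 * (1 - peak g)"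
proof -
  have o: "transpose g ** g = mat 1" using SO3_transpose_mult[OF g] by simp
  have "g $ 1 $ i * g $ 1 $ i + g $ 2 $ i * g $ 2 $ i + g $ 3 $ i * g $ 3 $ i = 1" for i
    using arg_cong[OF o, of "\<lambda>A. A $ i $ i"] by (simp add: matrix_matrix_mult_def transpose_def sum_3 mat_def)
  from this[of 1] this[of 2] this[of 3]
  have "(norm (g - mat 1))\<^sup>2 = 6 - 2 * (g $ 1 $ 1 + g $ 2 $ 2 + g $ 3 $ 3)"
    by (simp add: power2_norm_eq_inner inner_vec_def sum_3 mat_def algebra_simps)
  then show ?thesis by (simp add: peak_def trace_def sum_3 field_simps)
qed

text \<open>Laplace's method. If \<open>H (mat 1)\<close> were some \<open>c \<noteq> 0\<close>, the
  moment of \<open>H\<close> would differ from \<open>c\<close> times the moment of the constant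
  \<open>1\<close> by at most half of the latter's size, from the region near the identity, plus a
  term of order \<open>(1 - r) ^ n\<close> from elsewhere. The moment of \<open>1\<close> is at
  least of order \<open>(1 - r / 2) ^ n\<close>, so zero moments are impossible for large
  \<open>n\<close>.\<close>

lemma vanishing_at_one_if_peak_moments_zero:
  fixes H :: "real^3^3 \<Rightarrow> complex"
  assumes cont: "continuous_on SO3 H"
    and mom: "\<And>n. (\<integral>g. of_real (peak g ^ n) * H g \<partial>haar) = 0"
  shows "H (mat 1) = 0"
proof (rule ccontr)
  interpret prob_space haar by (rule prob_space_haar)
  assume "H (mat 1) \<noteq> 0"
  define c where "c = H (mat 1)"
  \<comment> \<open>One half of the main term absorbs the oscillation of \<open>H\<close> near the
    identity, the other half remains.\<close>
  define e where "e = cmod c / 2"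
  have e: "e > 0" using \<open>H (mat 1) \<noteq> 0\<close> by (simp add: e_def c_def)
  obtain d where d: "d > 0" "\<And>g. g \<in> SO3 \<Longrightarrow> dist g (mat 1) < d \<Longrightarrow> dist (H g) c < e"
    using cont[unfolded continuous_on_iff, rule_format, OF SO3_one e] by (auto simp: c_def)
  \<comment> \<open>The bound \<open>d\<^sup>2 / 8\<close> comes from
    \<open>norm_diff_one_SO3\<close>; the bound \<open>1/2\<close> keeps \<open>1 - r\<close>
    positive.\<close>
  define r where "r = min (1/2) (d\<^sup>2 / 8)"
  have r: "0 < r" "r < 1" "r \<le> d\<^sup>2 / 8" using d by (auto simp: r_def)
  have near: "cmod (H g - c) < e" if "g \<in> SO3" "peak g > 1 - r" for g
  proof -
    have "(norm (g - mat 1))\<^sup>2 < d\<^sup>2" using norm_diff_one_SO3[OF that(1)] that(2) r by simp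
    then have "norm (g - mat 1) < d" using d(1) by (simp add: power2_less_imp_less)
    then show ?thesis using d(2)[OF that(1)] by (simp add: dist_norm)
  qed
  obtain B where B: "\<And>g. g \<in> SO3 \<Longrightarrow> cmod (H g - c) \<le> B"
  proof -
    have "continuous_on SO3 (\<lambda>g. H g - c)" by (intro continuous_intros cont)
    from compact_imp_bounded[OF compact_continuous_image[OF this compact_SO3]] that show thesis
      by (auto simp: bounded_iff)
  qed
  have B0: "B \<ge> 0" using B[OF SO3_one] norm_ge_zero order_trans by blast
  \<comment> \<open>This threshold is nearer to \<open>1\<close> than \<open>1 - r\<close>, so the
    contribution of \<open>V\<close> decays strictly slower than the error term.\<close>
  define V where "V = {g :: real^3^3. peak g > 1 - r / 2}"
  have "open V" unfolding V_def
    by (intro open_Collect_less continuous_intros continuous_on_peak)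
  moreover have "mat 1 \<in> V" using r by (simp add: V_def peak_def trace_def sum_3 mat_def)
  ultimately have p: "measure haar (V \<inter> SO3) > 0" and VS: "V \<inter> SO3 \<in> sets haar"
    by (auto intro!: haar_nhd_pos simp: sets_haar sets_restrict_space)
  note ci = continuous_intros continuous_on_peak cont
  let ?J = "\<lambda>n. \<integral>g. peak g ^ n \<partial>haar"
  have iJ: "integrable haar (\<lambda>g. peak g ^ n)" for n by (intro haar_integrable ci)
  have key: "e * measure haar (V \<inter> SO3) \<le> B * ((1 - r) / (1 - r / 2)) ^ n" for n
  proof -
    have "0 = (\<integral>g. of_real (peak g ^ n) * c + of_real (peak g ^ n) * (H g - c) \<partial>haar)"
      using mom[of n] by (simp add: algebra_simps)
    also have "\<dots> = (\<integral>g. of_real (peak g ^ n) * c \<partial>haar) + (\<integral>g. of_real (peak g ^ n) * (H g - c) \<partial>haar)"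
      by (intro Bochner_Integration.integral_add haar_integrable ci)
    also have "(\<integral>g. of_real (peak g ^ n) * c \<partial>haar) = of_real (?J n) * c"
      by (subst integral_mult_left_zero) (simp only: integral_complex_of_real)
    finally have "of_real (?J n) * c = - (\<integral>g. of_real (peak g ^ n) * (H g - c) \<partial>haar)"
      by (simp add: eq_neg_iff_add_eq_0)
    then have "cmod (of_real (?J n) * c) = cmod (\<integral>g. of_real (peak g ^ n) * (H g - c) \<partial>haar)"
      by simp
    also have "\<dots> \<le> (\<integral>g. cmod (of_real (peak g ^ n) * (H g - c)) \<partial>haar)"
      by (rule integral_norm_bound)
    also have "\<dots> \<le> (\<integral>g. e * peak g ^ n + (1 - r) ^ n * B \<partial>haar)"
    proof (rule integral_mono)
      show "integrable haar (\<lambda>g. cmod (of_real (peak g ^ n) * (H g - c)))"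
        by (intro haar_integrable ci)
      show "integrable haar (\<lambda>g. e * peak g ^ n + (1 - r) ^ n * B)"
        by (intro haar_integrable ci)
      fix g assume "g \<in> space haar"
      then have g: "g \<in> SO3" by (simp add: space_haar)
      note pb = peak_bounds[OF g]
      have eq: "cmod (of_real (peak g ^ n) * (H g - c)) = peak g ^ n * cmod (H g - c)"
        using pb by (simp add: norm_mult norm_power)
      show "cmod (of_real (peak g ^ n) * (H g - c)) \<le> e * peak g ^ n + (1 - r) ^ n * B"
      proof (cases "peak g > 1 - r")
        case True
        have "peak g ^ n * cmod (H g - c) \<le> peak g ^ n * e"
          using near[OF g True] pb by (intro mult_left_mono) auto
        moreover have "0 \<le> (1 - r) ^ n * B" using r B0 by simp
        ultimately show ?thesis unfolding eq by (simp add: mult.commute)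
      next
        case False
        have "peak g ^ n * cmod (H g - c) \<le> (1 - r) ^ n * B"
          using False pb B[OF g] r by (intro mult_mono power_mono) auto
        moreover have "0 \<le> e * peak g ^ n" using e pb by simp
        ultimately show ?thesis unfolding eq by linarith
      qed
    qed
    also have "\<dots> = e * ?J n + (1 - r) ^ n * B" using iJ by (simp add: prob_space)
    finally have "cmod (of_real (?J n) * c) \<le> e * ?J n + (1 - r) ^ n * B" .
    moreover have J0: "?J n \<ge> 0" by (rule integral_nonneg_AE) (use peak_bounds in \<open>auto simp: space_haar\<close>)
    moreover have "cmod (of_real (?J n) * c) = e * ?J n + e * ?J n" using J0 by (simp add: norm_mult e_def)
    ultimately have up: "e * ?J n \<le> (1 - r) ^ n * B" by linarith
    have "measure haar (V \<inter> SO3) * (1 - r / 2) ^ n = (\<integral>g. indicat_real (V \<inter> SO3) g * (1 - r / 2) ^ n \<partial>haar)"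
      using VS by simp
    also have "\<dots> \<le> ?J n"
    proof (rule integral_mono[OF _ iJ])
      show "integrable haar (\<lambda>g. indicat_real (V \<inter> SO3) g * (1 - r / 2) ^ n)"
        using VS by (intro integrable_mult_left) (auto simp: less_top[symmetric])
      fix g assume "g \<in> space haar"
      then show "indicat_real (V \<inter> SO3) g * (1 - r / 2) ^ n \<le> peak g ^ n"
        using peak_bounds[of g] r by (auto simp: space_haar indicator_def V_def intro!: power_mono)
    qed
    finally have low: "measure haar (V \<inter> SO3) * (1 - r / 2) ^ n \<le> ?J n" .
    have "e * (measure haar (V \<inter> SO3) * (1 - r / 2) ^ n) \<le> e * ?J n"
      using low e by (intro mult_left_mono) auto
    with up have "e * measure haar (V \<inter> SO3) * (1 - r / 2) ^ n \<le> B * (1 - r) ^ n"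
      by (simp add: mult_ac)
    then show ?thesis using r by (simp add: power_divide pos_le_divide_eq)
  qed
  have "(\<lambda>n. B * ((1 - r) / (1 - r / 2)) ^ n) \<longlonglongrightarrow> B * 0"
    using r by (intro tendsto_mult_left LIMSEQ_power_zero) (auto simp: field_simps)
  then have "e * measure haar (V \<inter> SO3) \<le> B * 0"
    by (rule LIMSEQ_le_const) (use key in auto)
  with e p show False by (simp add: mult_le_0_iff)
qed

lemma vanishing_at_one_if_char_orthogonal:
  fixes T :: "nat \<Rightarrow> real^3^3 \<Rightarrow> int \<Rightarrow> int \<Rightarrow> complex"
  assumes T: "\<And>l. canonical_rep l (T l)" and cont: "continuous_on SO3 H"
    and orth: "\<And>l. (\<integral>g. rep_char l (T l) g * H g \<partial>haar) = 0"
  shows "H (mat 1) = 0"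
proof -
  let ?X = "\<lambda>l. rep_char l (T l)"
  have cX: "continuous_on SO3 (?X l)" for l
    unfolding rep_char_def by (intro continuous_intros canonical_repD(4)[OF T])
  \<comment> \<open>Weight zero is treated apart, because \<open>dirichlet_recurrence\<close> begins
    at weight one.\<close>
  have rec0: "4 * of_real (peak g) * ?X 0 g = ?X 0 g + ?X 1 g" if g: "g \<in> SO3" for g
  proof -
    obtain h \<alpha> where h: "h \<in> SO3" and g: "g = h ** rot_z \<alpha> ** transpose h" using SO3_conjugate_rot_z[OF g] .
    show ?thesis
      unfolding g rep_char_conjugate_rot_z[OF T h] peak_conjugate_rot_z[OF h]
      by (simp add: dirichlet_Suc dirichlet_0)
  qed
  have rec: "4 * of_real (peak g) * ?X (Suc l) g = 2 * ?X (Suc l) g + ?X (Suc (Suc l)) g + ?X l g"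
    if g: "g \<in> SO3" for g l
  proof -
    obtain h \<alpha> where h: "h \<in> SO3" and g: "g = h ** rot_z \<alpha> ** transpose h" using SO3_conjugate_rot_z[OF g] .
    show ?thesis
      unfolding g rep_char_conjugate_rot_z[OF T h] peak_conjugate_rot_z[OF h]
    proof -
      have "4 * complex_of_real ((1 + cos \<alpha>) / 2) * dirichlet (Suc l) \<alpha>
          = 2 * dirichlet (Suc l) \<alpha> + 2 * complex_of_real (cos \<alpha>) * dirichlet (Suc l) \<alpha>"
        by (simp add: algebra_simps)
      then show "4 * complex_of_real ((1 + cos \<alpha>) / 2) * dirichlet (Suc l) \<alpha>
          = 2 * dirichlet (Suc l) \<alpha> + dirichlet (Suc (Suc l)) \<alpha> + dirichlet l \<alpha>"
        unfolding dirichlet_recurrence by (simp only: add.assoc)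
    qed
  qed
  have one: "?X 0 g = 1" if g: "g \<in> SO3" for g
  proof -
    obtain h \<alpha> where h: "h \<in> SO3" and g: "g = h ** rot_z \<alpha> ** transpose h" using SO3_conjugate_rot_z[OF g] .
    show ?thesis unfolding g rep_char_conjugate_rot_z[OF T h] by (simp add: dirichlet_0)
  qed
  note ci = continuous_intros continuous_on_peak cont cX
  let ?I = "\<lambda>n l. \<integral>g. of_real (peak g ^ n) * (?X l g * H g) \<partial>haar"
  have int: "integrable haar (\<lambda>g. of_real (peak g ^ n) * (?X l g * H g))" for n l
    by (intro haar_integrable ci)
  \<comment> \<open>Induction on the power for all weights at once, since a factor
    \<open>peak\<close> spreads a weight over its neighbours.\<close>
  have "?I n l = 0" for n l
  proof (induction n arbitrary: l)
    case 0
    then show ?case using orth by simp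
  next
    case (Suc n)
    have pull: "4 * ?I (Suc n) l = (\<integral>g. of_real (peak g ^ n) * ((4 * of_real (peak g) * ?X l g) * H g) \<partial>haar)"
      by (subst integral_mult_right_zero[symmetric]) (simp add: mult_ac)
    show ?case
    proof (cases l)
      case 0
      have "4 * ?I (Suc n) l = (\<integral>g. of_real (peak g ^ n) * (?X 0 g * H g) + of_real (peak g ^ n) * (?X 1 g * H g) \<partial>haar)"
        unfolding pull unfolding 0 by (rule haar_integral_cong) (simp only: rec0 distrib_left distrib_right)
      also have "\<dots> = ?I n 0 + ?I n 1" by (rule Bochner_Integration.integral_add[OF int int])
      finally show ?thesis using Suc by simp
    next
      case (Suc k)
      have "4 * ?I (Suc n) l = (\<integral>g. 2 * (of_real (peak g ^ n) * (?X (Suc k) g * H g))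
          + of_real (peak g ^ n) * (?X (Suc (Suc k)) g * H g) + of_real (peak g ^ n) * (?X k g * H g) \<partial>haar)"
        unfolding pull unfolding Suc by (rule haar_integral_cong) (simp only: rec, simp only: distrib_left distrib_right mult_ac)
      also have "\<dots> = 2 * ?I n (Suc k) + ?I n (Suc (Suc k)) + ?I n k"
        using int by simp
      finally show ?thesis using Suc.IH by simp
    qed
  qed
  then have "(\<integral>g. of_real (peak g ^ n) * H g \<partial>haar) = 0" for n
    using haar_integral_cong[of "\<lambda>g. of_real (peak g ^ n) * (?X 0 g * H g)" "\<lambda>g. of_real (peak g ^ n) * H g"] one
    by simp
  then show ?thesis by (rule vanishing_at_one_if_peak_moments_zero[OF cont])
qed

section \<open>Fourier expansion of an isotropic process\<close>

lemma transpose_rot_z: "transpose (rot_z \<beta>) = rot_z (- \<beta>)"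
  by (simp add: rot_z_def vec_eq_iff forall_3 transpose_def)

text \<open>The difference is split as \<open>a * (X - Y) + (a - b) * Y\<close>. Both terms become
  small as \<open>a\<close> tends to \<open>b\<close> and \<open>X\<close> to \<open>Y\<close>,
  which gives continuity of the integrand of the Fourier coefficients.\<close>

lemma L2_sq_dist_scale_le:
  assumes "X \<in> L2_space M" "Y \<in> L2_space M"
  shows "L2_sq_dist M (\<lambda>\<omega>. a * X \<omega>) (\<lambda>\<omega>. b * Y \<omega>)
    \<le> 2 * (cmod a)\<^sup>2 * L2_sq_dist M X Y + 2 * (cmod (a - b))\<^sup>2 * (L2_norm M Y)\<^sup>2"
proof -
  have "(cmod (a * X \<omega> - b * Y \<omega>))\<^sup>2 \<le> 2 * (cmod a)\<^sup>2 * (cmod (X \<omega> - Y \<omega>))\<^sup>2 + 2 * (cmod (a - b))\<^sup>2 * (cmod (Y \<omega>))\<^sup>2" for \<omega>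
  proof -
    have "a * X \<omega> - b * Y \<omega> = a * (X \<omega> - Y \<omega>) + (a - b) * Y \<omega>" by (simp add: algebra_simps)
    then have "(cmod (a * X \<omega> - b * Y \<omega>))\<^sup>2 \<le> (cmod (a * (X \<omega> - Y \<omega>)) + cmod ((a - b) * Y \<omega>))\<^sup>2"
      by (metis norm_triangle_ineq norm_ge_zero power_mono)
    also have "\<dots> \<le> 2 * (cmod (a * (X \<omega> - Y \<omega>)))\<^sup>2 + 2 * (cmod ((a - b) * Y \<omega>))\<^sup>2"
      using two_mult_le[of "cmod (a * (X \<omega> - Y \<omega>))" "cmod ((a - b) * Y \<omega>)"] by (simp add: power2_sum)
    finally show ?thesis by (simp add: norm_mult power_mult_distrib)
  qed
  moreover note L2_spaceD(2)[OF L2_space_diff[OF L2_space_cmult[OF assms(1)] L2_space_cmult[OF assms(2)]]]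
    L2_spaceD(2)[OF L2_space_diff[OF assms]] L2_spaceD(2)[OF assms(2)]
  ultimately have "L2_sq_dist M (\<lambda>\<omega>. a * X \<omega>) (\<lambda>\<omega>. b * Y \<omega>)
      \<le> (\<integral>\<omega>. 2 * (cmod a)\<^sup>2 * (cmod (X \<omega> - Y \<omega>))\<^sup>2 + 2 * (cmod (a - b))\<^sup>2 * (cmod (Y \<omega>))\<^sup>2 \<partial>M)"
    unfolding L2_sq_dist_def by (intro integral_mono) auto
  also have "\<dots> = 2 * (cmod a)\<^sup>2 * L2_sq_dist M X Y + 2 * (cmod (a - b))\<^sup>2 * (L2_norm M Y)\<^sup>2"
    using L2_spaceD(2)[OF L2_space_diff[OF assms]] L2_spaceD(2)[OF assms(2)]
    by (simp add: L2_sq_dist_def L2_norm_square)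
  finally show ?thesis .
qed

lemma ms_continuous_scale:
  assumes Y: "ms_continuous M Y" and c: "continuous_on SO3 c"
  shows "ms_continuous M (\<lambda>g \<omega>. c g * Y g \<omega>)"
  unfolding ms_continuous_def
proof (intro conjI ballI)
  fix g assume g: "g \<in> SO3"
  show "(\<lambda>\<omega>. c g * Y g \<omega>) \<in> L2_space M"
    using Y g by (auto simp: ms_continuous_def intro: L2_space_cmult)
  have c_lim: "(c \<longlongrightarrow> c g) (at g within SO3)" using c g by (auto simp: continuous_on_def)
  have Y_lim: "((\<lambda>h. L2_sq_dist M (Y h) (Y g)) \<longlongrightarrow> 0) (at g within SO3)"
    using Y g by (auto simp: ms_continuous_def)
  have "((\<lambda>h. 2 * (cmod (c h))\<^sup>2 * L2_sq_dist M (Y h) (Y g) + 2 * (cmod (c h - c g))\<^sup>2 * (L2_norm M (Y g))\<^sup>2)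
      \<longlongrightarrow> 2 * (cmod (c g))\<^sup>2 * 0 + 2 * (cmod (c g - c g))\<^sup>2 * (L2_norm M (Y g))\<^sup>2) (at g within SO3)"
    by (intro tendsto_intros c_lim Y_lim)
  then have lim: "((\<lambda>h. 2 * (cmod (c h))\<^sup>2 * L2_sq_dist M (Y h) (Y g) + 2 * (cmod (c h - c g))\<^sup>2 * (L2_norm M (Y g))\<^sup>2)
      \<longlongrightarrow> 0) (at g within SO3)" by simp
  show "((\<lambda>h. L2_sq_dist M (\<lambda>\<omega>. c h * Y h \<omega>) (\<lambda>\<omega>. c g * Y g \<omega>)) \<longlongrightarrow> 0) (at g within SO3)"
  proof (rule Lim_null_comparison[OF _ lim])
    have "norm (L2_sq_dist M (\<lambda>\<omega>. c h * Y h \<omega>) (\<lambda>\<omega>. c g * Y g \<omega>))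
        \<le> 2 * (cmod (c h))\<^sup>2 * L2_sq_dist M (Y h) (Y g) + 2 * (cmod (c h - c g))\<^sup>2 * (L2_norm M (Y g))\<^sup>2"
      if "h \<in> SO3" for h
      using L2_sq_dist_scale_le[of "Y h" M "Y g" "c h" "c g"] Y g that
      by (simp add: ms_continuous_def L2_sq_dist_norm)
    then show "\<forall>\<^sub>F h in at g within SO3. norm (L2_sq_dist M (\<lambda>\<omega>. c h * Y h \<omega>) (\<lambda>\<omega>. c g * Y g \<omega>))
        \<le> 2 * (cmod (c h))\<^sup>2 * L2_sq_dist M (Y h) (Y g) + 2 * (cmod (c h - c g))\<^sup>2 * (L2_norm M (Y g))\<^sup>2"
      by (auto simp: eventually_at_filter)
  qed
qed

lemma ms_continuous_weak_integral:
  assumes "prob_space M" "ms_continuous M Y"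
  shows "\<exists>\<zeta>\<in>L2_space M. \<forall>V\<in>L2_space M. L2_inner M \<zeta> V = (\<integral>g. L2_inner M (Y g) V \<partial>haar)"
  by (rule weak_L2_integral[OF assms(1) prob_space_haar sets_haar compact_SO3, of Y])
     (use assms(2) in \<open>auto simp: ms_continuous_def\<close>)

text \<open>\<open>rot\<close> records the phase factor of the process as a property of its
  covariance. \<open>j\<close> will be \<open>2\<close> for \<open>A\<close> and \<open>-2\<close>
  for \<open>B\<close>, so that both share one argument.\<close>

locale isotropic_process =
  fixes M :: "'w measure" and T :: "nat \<Rightarrow> real^3^3 \<Rightarrow> int \<Rightarrow> int \<Rightarrow> complex"
    and Y :: "real^3^3 \<Rightarrow> 'w \<Rightarrow> complex" and j :: int
  assumes prob: "prob_space M"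
    and T: "\<And>l. canonical_rep l (T l)"
    and iso: "weakly_isotropic M Y"
    and ms: "ms_continuous M Y"
    and rot: "\<And>u \<beta>. u \<in> SO3 \<Longrightarrow>
      L2_inner M (Y (mat 1)) (Y (u ** rot_z \<beta>)) = cis (- (of_int j * \<beta>)) * L2_inner M (Y (mat 1)) (Y u)"
begin

lemma Y_L2: "g \<in> SO3 \<Longrightarrow> Y g \<in> L2_space M"
  using iso by (simp add: weakly_isotropic_def)

definition K :: "real^3^3 \<Rightarrow> complex" where
  "K u = L2_inner M (Y (mat 1)) (Y u)"

lemma inner_Y:
  assumes "g \<in> SO3" "h \<in> SO3"
  shows "L2_inner M (Y g) (Y h) = K (transpose g ** h)"
proof -
  have "L2_inner M (Y (transpose g ** g)) (Y (transpose g ** h)) = L2_inner M (Y g) (Y h)"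
    using iso assms SO3_transpose by (simp add: weakly_isotropic_def)
  then show ?thesis by (simp add: SO3_transpose_mult[OF assms(1)] K_def)
qed

lemma continuous_on_inner_Y: "V \<in> L2_space M \<Longrightarrow> continuous_on SO3 (\<lambda>g. L2_inner M (Y g) V)"
  using ms by (intro continuous_on_L2_inner_left) (auto simp: ms_continuous_def)

lemma continuous_on_K: "continuous_on SO3 K"
proof -
  have "continuous_on SO3 (\<lambda>g. cnj (L2_inner M (Y g) (Y (mat 1))))"
    by (intro continuous_intros continuous_on_inner_Y Y_L2 SO3_one)
  then show ?thesis by (simp add: K_def[abs_def] flip: L2_inner_commute)
qed

lemma continuous_on_K_transpose: "continuous_on SO3 (\<lambda>w. K (transpose w))"
  by (intro continuous_on_SO3_compose[OF continuous_on_K] continuous_intros SO3_transpose)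

lemma K_one_nonneg: "K (mat 1) = of_real ((L2_norm M (Y (mat 1)))\<^sup>2)"
  by (simp add: K_def L2_inner_self)

text \<open>This is the inner product of \<open>\<zeta> l j\<close> with \<open>Y (mat 1)\<close>,
  since \<open>K (transpose w)\<close> is the covariance of \<open>Y w\<close> and
  \<open>Y (mat 1)\<close>.\<close>

definition coef :: "nat \<Rightarrow> complex" where
  "coef l = (\<integral>w. T l w j j * K (transpose w) \<partial>haar)"

lemma integrable_T_K: "integrable haar (\<lambda>w. T l w s t * K (transpose w))"
  by (intro haar_integrable continuous_intros canonical_repD(4)[OF T] continuous_on_K_transpose)

text \<open>Translation by \<open>rot_z \<beta>\<close> multiplies the matrix entry by one phase and
  the covariance by another. The transpose turns the left translation into the right multiplication
  that \<open>rot\<close> describes.\<close>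

lemma integral_T_K_eq_0:
  assumes "s \<noteq> j"
  shows "(\<integral>w. T l w s t * K (transpose w) \<partial>haar) = 0"
proof (cases "s \<in> degs l")
  case True
  let ?I = "\<integral>w. T l w s t * K (transpose w) \<partial>haar"
  \<comment> \<open>This angle makes the combined phase \<open>-1\<close>.\<close>
  define \<beta> where "\<beta> = pi / of_int (j - s)"
  have "?I = (\<integral>w. T l (rot_z \<beta> ** w) s t * K (transpose (rot_z \<beta> ** w)) \<partial>haar)"
    by (rule haar_integral_translate[OF rot_z_SO3, symmetric])
       (intro continuous_intros canonical_repD(4)[OF T] continuous_on_K_transpose)
  also have "\<dots> = (\<integral>w. cis (of_int (j - s) * \<beta>) * (T l w s t * K (transpose w)) \<partial>haar)"
  proof (rule haar_integral_cong)
    fix w assume w: "w \<in> SO3"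
    have "T l (rot_z \<beta> ** w) s t = (\<Sum>r\<in>degs l. if r = s then cis (- (of_int s * \<beta>)) * T l w s t else 0)"
      unfolding canonical_repD(2)[OF T rot_z_SO3 w]
      using canonical_repD(6)[OF T True] by (intro sum.cong refl) auto
    moreover have "K (transpose (rot_z \<beta> ** w)) = cis (of_int j * \<beta>) * K (transpose w)"
      using rot[OF SO3_transpose[OF w], of "- \<beta>"] by (simp add: K_def matrix_transpose_mul transpose_rot_z)
    moreover have "cis (of_int (j - s) * \<beta>) = cis (- (of_int s * \<beta>)) * cis (of_int j * \<beta>)"
      by (simp add: cis_mult algebra_simps)
    ultimately show "T l (rot_z \<beta> ** w) s t * K (transpose (rot_z \<beta> ** w))
        = cis (of_int (j - s) * \<beta>) * (T l w s t * K (transpose w))"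
      using True by simp
  qed
  also have "\<dots> = cis (of_int (j - s) * \<beta>) * ?I" by simp
  also have "of_int (j - s) * \<beta> = pi"
    using assms by (simp add: \<beta>_def flip: of_int_diff)
  finally show ?thesis by simp
qed (simp add: canonical_repD(1)[OF T])

lemma coef_eq_0: "j \<notin> degs l \<Longrightarrow> coef l = 0"
  by (simp add: coef_def canonical_repD(1)[OF T])

text \<open>The inner products determine the variable only up to a null set, hence the
  choice.\<close>

definition \<zeta> :: "nat \<Rightarrow> int \<Rightarrow> 'w \<Rightarrow> complex" where
  "\<zeta> l m = (SOME z. z \<in> L2_space M \<and>
     (\<forall>V\<in>L2_space M. L2_inner M z V = (\<integral>g. T l g m j * L2_inner M (Y g) V \<partial>haar)))"

lemma \<zeta>: "\<zeta> l m \<in> L2_space M"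
  "V \<in> L2_space M \<Longrightarrow> L2_inner M (\<zeta> l m) V = (\<integral>g. T l g m j * L2_inner M (Y g) V \<partial>haar)"
proof -
  have "\<exists>z. z \<in> L2_space M \<and>
     (\<forall>V\<in>L2_space M. L2_inner M z V = (\<integral>g. T l g m j * L2_inner M (Y g) V \<partial>haar))"
    using ms_continuous_weak_integral[OF prob ms_continuous_scale[OF ms canonical_repD(4)[OF T[of l], of m j]]]
    by (simp add: L2_inner_cmult_left Bex_def)
  from someI_ex[OF this]
  show "\<zeta> l m \<in> L2_space M"
    "V \<in> L2_space M \<Longrightarrow> L2_inner M (\<zeta> l m) V = (\<integral>g. T l g m j * L2_inner M (Y g) V \<partial>haar)"
    by (auto simp: \<zeta>_def)
qed

text \<open>Translation by \<open>h\<close> removes \<open>h\<close> from the covariance. Expanding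
  \<open>T l (h ** g) m j\<close> then leaves only the term with label \<open>j\<close>, by
  \<open>integral_T_K_eq_0\<close>.\<close>

lemma inner_\<zeta>_Y:
  assumes h: "h \<in> SO3"
  shows "L2_inner M (\<zeta> l m) (Y h) = coef l * T l h m j"
proof -
  have "L2_inner M (\<zeta> l m) (Y h) = (\<integral>g. T l g m j * L2_inner M (Y g) (Y h) \<partial>haar)"
    using \<zeta>(2)[OF Y_L2[OF h]] .
  also have "\<dots> = (\<integral>g. T l (h ** g) m j * L2_inner M (Y (h ** g)) (Y h) \<partial>haar)"
    by (rule haar_integral_translate[OF h, symmetric])
       (intro continuous_intros canonical_repD(4)[OF T] continuous_on_inner_Y Y_L2 h)
  also have "\<dots> = (\<integral>g. (\<Sum>s\<in>degs l. T l h m s * (T l g s j * K (transpose g))) \<partial>haar)"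
  proof (rule haar_integral_cong)
    fix g assume g: "g \<in> SO3"
    have "transpose (h ** g) ** h = transpose g ** (transpose h ** h)"
      by (simp add: matrix_transpose_mul matrix_mul_assoc)
    then have "L2_inner M (Y (h ** g)) (Y h) = K (transpose g)"
      using inner_Y[OF SO3_mult[OF h g] h] by (simp add: SO3_transpose_mult[OF h])
    then show "T l (h ** g) m j * L2_inner M (Y (h ** g)) (Y h) = (\<Sum>s\<in>degs l. T l h m s * (T l g s j * K (transpose g)))"
      by (simp add: canonical_repD(2)[OF T h g] sum_distrib_right mult.assoc)
  qed
  also have "\<dots> = (\<Sum>s\<in>degs l. T l h m s * (\<integral>g. T l g s j * K (transpose g) \<partial>haar))"
    using integrable_T_K by simp
  also have "\<dots> = (\<Sum>s\<in>degs l. if s = j then T l h m j * coef l else 0)"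
    using integral_T_K_eq_0 by (intro sum.cong refl) (auto simp: coef_def)
  also have "\<dots> = coef l * T l h m j"
    using coef_eq_0[of l] by (auto simp: mult.commute)
  finally show ?thesis .
qed

text \<open>The inner products with \<open>Y g\<close> are known, so the double integral collapses
  to one integral of matrix entries, to which Schur orthogonality applies. If \<open>j\<close> is
  not a label of weight \<open>l\<close>, both sides are zero.\<close>

lemma inner_\<zeta>_\<zeta>:
  assumes m: "m \<in> degs l" "m' \<in> degs l'"
  shows "L2_inner M (\<zeta> l m) (\<zeta> l' m') = of_bool (l = l') * of_bool (m = m') * (cnj (coef l) / of_nat (2 * l + 1))"
proof -
  have "L2_inner M (\<zeta> l m) (\<zeta> l' m') = (\<integral>g. T l g m j * L2_inner M (Y g) (\<zeta> l' m') \<partial>haar)"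
    by (rule \<zeta>(2)[OF \<zeta>(1)])
  also have "\<dots> = (\<integral>g. cnj (coef l') * (T l g m j * cnj (T l' g m' j)) \<partial>haar)"
    by (rule haar_integral_cong) (simp add: inner_\<zeta>_Y L2_inner_commute[of _ "Y _"] mult_ac)
  also have "\<dots> = cnj (coef l') * (\<integral>g. T l g m j * cnj (T l' g m' j) \<partial>haar)" by simp
  finally have eq: "L2_inner M (\<zeta> l m) (\<zeta> l' m') = cnj (coef l') * (\<integral>g. T l g m j * cnj (T l' g m' j) \<partial>haar)" .
  show ?thesis
  proof (cases "l = l' \<and> m = m'")
    case True
    then show ?thesis
      using schur_orthogonality_norm[OF T m(1), of j] coef_eq_0[of l] unfolding eq
      by (cases "j \<in> degs l") auto
  next
    case False
    then have "(\<integral>g. T l g m j * cnj (T l' g m' j) \<partial>haar) = 0"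
      using schur_orthogonality_weight[OF T T _ m] schur_orthogonality_row[OF T T m] by blast
    then show ?thesis using False unfolding eq by auto
  qed
qed

text \<open>\<open>coef l\<close> in a form that shows it to be real and nonnegative, see
  \<open>coef_eq_r\<close>. The label \<open>0\<close> belongs to every weight.\<close>

definition r :: "nat \<Rightarrow> real" where
  "r l = of_nat (2 * l + 1) * (L2_norm M (\<zeta> l 0))\<^sup>2"

lemma r_nonneg: "r l \<ge> 0"
  by (simp add: r_def)

lemma coef_eq_r: "coef l = of_real (r l)"
proof -
  have n: "of_nat (2 * l + 1) \<noteq> (0 :: complex)" by (metis of_nat_eq_0_iff add_is_0 one_neq_zero)
  have "of_real ((L2_norm M (\<zeta> l 0))\<^sup>2) = cnj (coef l) / of_nat (2 * l + 1)"
    using inner_\<zeta>_\<zeta>[of 0 l 0 l] by (simp add: L2_inner_self)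
  then have "cnj (coef l) = of_real (r l)"
    using n by (simp add: r_def field_simps del: of_nat_add of_nat_mult)
  then have "cnj (cnj (coef l)) = cnj (of_real (r l))" by simp
  then show ?thesis by simp
qed

lemma r_eq_0: "j \<notin> degs l \<Longrightarrow> r l = 0"
  using coef_eq_0[of l] by (simp add: coef_eq_r)

text \<open>The factor that appears when \<open>Y g\<close> is paired with the normalised variables,
  see \<open>inner_Y_W\<close>.\<close>

definition a :: "nat \<Rightarrow> real" where
  "a l = sqrt (of_nat (2 * l + 1) * r l)"

text \<open>For \<open>r l > 0\<close> this is \<open>\<zeta> l m\<close> scaled to norm one. For
  \<open>r l = 0\<close> division by zero gives zero, and so \<open>W l m\<close> is zero;
  \<open>Z\<close> replaces it there.\<close>

definition W :: "nat \<Rightarrow> int \<Rightarrow> 'w \<Rightarrow> complex" where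
  "W l m = (\<lambda>\<omega>. of_real (sqrt (of_nat (2 * l + 1) / r l)) * \<zeta> l m \<omega>)"

lemma a_eq_0_iff: "a l = 0 \<longleftrightarrow> r l = 0"
  by (simp add: a_def)

lemma a_sq: "(a l)\<^sup>2 = of_nat (2 * l + 1) * r l"
  using r_nonneg by (simp add: a_def)

lemma a_zero_outside: "j \<notin> degs l \<Longrightarrow> a l = 0"
  by (simp add: a_eq_0_iff r_eq_0)

lemma W_L2: "W l m \<in> L2_space M"
  unfolding W_def by (intro L2_space_cmult \<zeta>)

lemma W_orthonormal:
  assumes "m \<in> degs l" "m' \<in> degs l'" "a l \<noteq> 0"
  shows "L2_inner M (W l m) (W l' m') = of_bool (l = l') * of_bool (m = m')"
proof -
  have r: "r l > 0" using assms(3) r_nonneg[of l] by (simp add: a_eq_0_iff)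
  have n: "real (2 * l + 1) > 0" by simp
  have "sqrt (real (2 * l + 1) / r l) * sqrt (real (2 * l + 1) / r l) * (r l / real (2 * l + 1)) = 1"
    using r n by (simp only: real_sqrt_mult_self abs_of_pos divide_pos_pos times_divide_times_eq mult.commute)
      (simp del: of_nat_add of_nat_mult)
  then have "complex_of_real (sqrt (real (2 * l + 1) / r l)) * complex_of_real (sqrt (real (2 * l + 1) / r l)) *
      (complex_of_real (r l) / of_nat (2 * l + 1)) = 1"
    by (metis of_real_1 of_real_divide of_real_mult of_real_of_nat_eq)
  then show ?thesis
    using assms(1,2)
    by (auto simp: W_def L2_inner_cmult_left L2_inner_cmult_right inner_\<zeta>_\<zeta> coef_eq_r mult.assoc
        simp del: of_nat_add of_nat_mult)
qed

lemma inner_Y_W: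
  assumes "g \<in> SO3"
  shows "L2_inner M (Y g) (W l m) = of_real (a l) * T l (transpose g) j m"
proof -
  \<comment> \<open>This also covers \<open>r l = 0\<close>, where both sides vanish.\<close>
  have "sqrt (real (2 * l + 1) / r l) * r l = a l"
    using real_div_sqrt[OF r_nonneg[of l]] unfolding a_def real_sqrt_divide real_sqrt_mult
    by (metis times_divide_eq_left times_divide_eq_right)
  then have "complex_of_real (sqrt (real (2 * l + 1) / r l)) * complex_of_real (r l) = complex_of_real (a l)"
    by (metis of_real_mult)
  then show ?thesis
    by (simp add: W_def L2_inner_cmult_right L2_inner_commute[of M "Y g"] inner_\<zeta>_Y[OF assms] coef_eq_r
        canonical_rep_transpose[OF T assms] flip: mult.assoc del: of_nat_add of_nat_mult)
qed

text \<open>By \<open>inner_Y_W\<close> the coefficients are the inner products of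
  \<open>Y g\<close> with \<open>W l m\<close>, so this is the orthogonal projection of
  \<open>Y g\<close> onto the span of the variables of weight \<open>l\<close>.\<close>

definition f :: "real^3^3 \<Rightarrow> nat \<Rightarrow> 'w \<Rightarrow> complex" where
  "f g l = (\<lambda>\<omega>. \<Sum>m\<in>degs l. (of_real (a l) * T l (transpose g) j m) * W l m \<omega>)"

lemma f_L2: "f g l \<in> L2_space M"
  unfolding f_def by (intro L2_space_intros W_L2)

lemma T_transpose_mult:
  assumes "g \<in> SO3" "h \<in> SO3"
  shows "(\<Sum>m\<in>degs l. T l (transpose g) j m * cnj (T l (transpose h) j m)) = T l (transpose g ** h) j j"
  using canonical_repD(2)[OF T SO3_transpose[OF assms(1)] assms(2), of l j j]
  by (simp add: canonical_rep_transpose[OF T assms(2)])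

lemma inner_f_Y:
  assumes g: "g \<in> SO3" and h: "h \<in> SO3"
  shows "L2_inner M (f g l) (Y h) = of_real ((a l)\<^sup>2) * T l (transpose g ** h) j j"
proof -
  have "L2_inner M (f g l) (Y h) = (\<Sum>m\<in>degs l. (of_real (a l) * T l (transpose g) j m) * L2_inner M (W l m) (Y h))"
    unfolding f_def
    by (subst L2_inner_sum_left) (auto intro: L2_space_cmult W_L2 Y_L2 h simp: L2_inner_cmult_left)
  also have "\<dots> = of_real ((a l)\<^sup>2) * (\<Sum>m\<in>degs l. T l (transpose g) j m * cnj (T l (transpose h) j m))"
    by (simp add: L2_inner_commute[of M "W _ _"] inner_Y_W[OF h] sum_distrib_left power2_eq_square mult_ac)
  finally show ?thesis by (simp only: T_transpose_mult[OF g h])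
qed

lemma inner_f_f:
  assumes g: "g \<in> SO3"
  shows "L2_inner M (f g l) (f g l') = of_bool (l = l') * of_real ((a l)\<^sup>2)"
proof -
  have fW: "L2_inner M (f g l) (W l' m') = of_bool (l = l') * (of_real (a l) * T l (transpose g) j m')"
    if m': "m' \<in> degs l'" for m'
  proof -
    have "L2_inner M (f g l) (W l' m') = (\<Sum>m\<in>degs l. (of_real (a l) * T l (transpose g) j m) * L2_inner M (W l m) (W l' m'))"
      unfolding f_def
      by (subst L2_inner_sum_left) (auto intro: L2_space_cmult W_L2 simp: L2_inner_cmult_left)
    also have "\<dots> = (\<Sum>m\<in>degs l. if m = m' then of_bool (l = l') * (of_real (a l) * T l (transpose g) j m') else 0)"
      using W_orthonormal[OF _ m'] by (intro sum.cong refl) (cases "a l = 0"; auto)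
    also have "\<dots> = of_bool (l = l') * (of_real (a l) * T l (transpose g) j m')"
      using m' by auto
    finally show ?thesis .
  qed
  have "L2_inner M (f g l) (f g l') = (\<Sum>m'\<in>degs l'. cnj (of_real (a l') * T l' (transpose g) j m') * L2_inner M (f g l) (W l' m'))"
    unfolding f_def[of g l']
    by (subst L2_inner_sum_right) (auto intro: L2_space_cmult W_L2 f_L2 simp: L2_inner_cmult_right)
  also have "\<dots> = of_bool (l = l') * (of_real ((a l)\<^sup>2) * (\<Sum>m\<in>degs l. T l (transpose g) j m * cnj (T l (transpose g) j m)))"
    using fW by (cases "l = l'") (auto simp: sum_distrib_left power2_eq_square mult_ac)
  also have "of_real ((a l)\<^sup>2) * (\<Sum>m\<in>degs l. T l (transpose g) j m * cnj (T l (transpose g) j m)) = of_real ((a l)\<^sup>2)"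
    unfolding T_transpose_mult[OF g g] SO3_transpose_mult[OF g]
    using canonical_rep_one[OF T, of j l j] a_zero_outside[of l] by (cases "j \<in> degs l") auto
  finally show ?thesis .
qed

text \<open>The partial sum is a projection of \<open>Y g\<close>: its inner products with
  \<open>Y g\<close> and with itself agree, and Pythagoras applies.\<close>

lemma sq_dist_partial_sum:
  assumes g: "g \<in> SO3"
  shows "L2_sq_dist M (\<lambda>\<omega>. \<Sum>l<L. f g l \<omega>) (Y g) = (L2_norm M (Y (mat 1)))\<^sup>2 - (\<Sum>l<L. (a l)\<^sup>2)"
proof -
  let ?S = "\<lambda>\<omega>. \<Sum>l<L. f g l \<omega>"
  let ?s = "complex_of_real (\<Sum>l<L. (a l)\<^sup>2)"
  have S: "?S \<in> L2_space M" by (intro L2_space_sum f_L2)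
  \<comment> \<open>In a weight without the label \<open>j\<close> the diagonal entry is
    \<open>0\<close> and not \<open>1\<close>, but there \<open>a l\<close> is zero as well.\<close>
  have one: "of_real ((a l)\<^sup>2) * T l (transpose g ** g) j j = of_real ((a l)\<^sup>2)" for l
    unfolding SO3_transpose_mult[OF g]
    using canonical_rep_one[OF T, of j l j] a_zero_outside[of l] by (cases "j \<in> degs l") auto
  have SY: "L2_inner M ?S (Y g) = ?s"
    by (subst L2_inner_sum_left) (simp_all add: f_L2 Y_L2 g inner_f_Y one del: of_real_power)
  then have YS: "L2_inner M (Y g) ?S = ?s" by (subst L2_inner_commute) simp
  have "L2_inner M ?S ?S = (\<Sum>l<L. \<Sum>l'<L. L2_inner M (f g l) (f g l'))"
    using S by (simp add: L2_inner_sum_left L2_inner_sum_right f_L2)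
  also have "\<dots> = (\<Sum>l<L. \<Sum>l'<L. if l' = l then of_real ((a l)\<^sup>2) else 0)"
    by (intro sum.cong refl) (simp add: inner_f_f[OF g])
  also have "\<dots> = ?s" by simp
  finally have SS: "L2_inner M ?S ?S = ?s" .
  have YY: "L2_inner M (Y g) (Y g) = of_real ((L2_norm M (Y (mat 1)))\<^sup>2)"
    using inner_Y[OF g g] by (simp add: SO3_transpose_mult[OF g] K_one_nonneg)
  have "complex_of_real (L2_sq_dist M ?S (Y g)) = L2_inner M (\<lambda>\<omega>. ?S \<omega> - Y g \<omega>) (\<lambda>\<omega>. ?S \<omega> - Y g \<omega>)"
    by (simp add: L2_inner_self L2_sq_dist_norm)
  also have "\<dots> = complex_of_real ((L2_norm M (Y (mat 1)))\<^sup>2 - (\<Sum>l<L. (a l)\<^sup>2))"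
    using S Y_L2[OF g] by (simp add: L2_inner_diff_left L2_inner_diff_right L2_space_diff SY YS SS YY)
  finally show ?thesis by (simp only: of_real_eq_iff)
qed

section \<open>Bessel's inequality and completeness\<close>

lemma sum_a_sq_le: "(\<Sum>l<L. (a l)\<^sup>2) \<le> (L2_norm M (Y (mat 1)))\<^sup>2"
  using sq_dist_partial_sum[OF SO3_one, of L] by (simp add: L2_sq_dist_norm) (smt (verit) zero_le_power2)

lemma summable_a_sq: "summable (\<lambda>l. (a l)\<^sup>2)"
  by (rule summableI_nonneg_bounded[OF _ sum_a_sq_le]) simp

lemma a_sq_T_bound: "u \<in> SO3 \<Longrightarrow> cmod (of_real ((a l)\<^sup>2) * T l u j j) \<le> (a l)\<^sup>2"
  using canonical_rep_norm_le_one[OF T, of u l j j]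
  by (simp add: norm_mult norm_power mult_left_le)

text \<open>The covariance minus its expected series, read at the inverse, so that unitarity turns
  the terms into conjugates of matrix entries as Schur orthogonality requires.\<close>

definition residual :: "real^3^3 \<Rightarrow> complex" where
  "residual w = K (transpose w) - (\<Sum>l. of_real ((a l)\<^sup>2) * T l (transpose w) j j)"

lemma continuous_on_T_transpose: "continuous_on SO3 (\<lambda>w. T l (transpose w) m n)"
  by (intro continuous_on_SO3_compose[OF canonical_repD(4)[OF T]] continuous_intros SO3_transpose)

text \<open>Entries of unitary matrices are bounded by \<open>1\<close>, so the summable
  \<open>(a l)\<^sup>2\<close> dominate the series uniformly.\<close>

lemma continuous_on_residual: "continuous_on SO3 residual"
proof -
  have "uniform_limit SO3 (\<lambda>n w. \<Sum>l<n. of_real ((a l)\<^sup>2) * T l (transpose w) j j)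
      (\<lambda>w. \<Sum>l. of_real ((a l)\<^sup>2) * T l (transpose w) j j) sequentially"
    by (rule Weierstrass_m_test[OF _ summable_a_sq]) (rule a_sq_T_bound[OF SO3_transpose])
  then have "continuous_on SO3 (\<lambda>w. \<Sum>l. of_real ((a l)\<^sup>2) * T l (transpose w) j j)"
    by (rule uniform_limit_theorem[rotated])
       (auto intro!: always_eventually continuous_intros continuous_on_T_transpose)
  then show ?thesis
    unfolding residual_def[abs_def] by (intro continuous_intros continuous_on_K_transpose)
qed

text \<open>Against the character of weight \<open>l\<close> both parts give \<open>coef l\<close>.
  In \<open>K\<close> only the diagonal entry with label \<open>j\<close> contributes; in the series
  only the term of weight \<open>l\<close> does, and \<open>(a l)\<^sup>2 / (2 * l + 1)\<close>
  equals \<open>coef l\<close>.\<close>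

lemma residual_orthogonal_char: "(\<integral>w. rep_char l (T l) w * residual w \<partial>haar) = 0"
proof -
  interpret haar: prob_space haar by (rule prob_space_haar)
  let ?X = "rep_char l (T l)"
  let ?t = "\<lambda>k w. of_real ((a k)\<^sup>2) * T k (transpose w) j j"
  have cX: "continuous_on SO3 ?X"
    unfolding rep_char_def by (intro continuous_intros canonical_repD(4)[OF T])
  have t_int: "(\<integral>w. ?X w * ?t k w \<partial>haar) = of_bool (k = l) * coef l" for k
  proof -
    have "(\<integral>w. ?X w * ?t k w \<partial>haar) = (\<integral>w. (\<Sum>m\<in>degs l. of_real ((a k)\<^sup>2) * (T l w m m * cnj (T k w j j))) \<partial>haar)"
      by (rule haar_integral_cong)
         (simp add: rep_char_def canonical_rep_transpose[OF T] sum_distrib_left sum_distrib_right mult_ac)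
    also have "\<dots> = (\<Sum>m\<in>degs l. of_real ((a k)\<^sup>2) * (\<integral>w. T l w m m * cnj (T k w j j) \<partial>haar))"
      using canonical_rep_integrable[OF T T] by simp
    also have "\<dots> = (\<Sum>m\<in>degs l. if m = j then of_bool (k = l) * coef l else 0)"
    proof (rule sum.cong[OF refl])
      fix m assume m: "m \<in> degs l"
      show "of_real ((a k)\<^sup>2) * (\<integral>w. T l w m m * cnj (T k w j j) \<partial>haar) = (if m = j then of_bool (k = l) * coef l else 0)"
      proof (cases "j \<in> degs k")
        case False
        then show ?thesis using a_zero_outside[of k] m by auto
      next
        case True
        show ?thesis
        proof (cases "k = l \<and> m = j")
          case True
          have "of_nat (2 * l + 1) \<noteq> (0 :: complex)" by (metis of_nat_eq_0_iff add_is_0 one_neq_zero)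
          then show ?thesis
            using True schur_orthogonality_norm[OF T m m]
            by (simp add: a_sq coef_eq_r del: of_nat_add of_nat_mult)
        next
          case False
          then have "(\<integral>w. T l w m m * cnj (T k w j j) \<partial>haar) = 0"
            using schur_orthogonality_weight[OF T T _ m True] schur_orthogonality_row[OF T T m True] by blast
          then show ?thesis using False by auto
        qed
      qed
    qed
    also have "\<dots> = of_bool (k = l) * coef l" using coef_eq_0[of l] by auto
    finally show ?thesis .
  qed
  obtain B where B: "\<And>w. w \<in> SO3 \<Longrightarrow> cmod (?X w) \<le> B"
    using compact_imp_bounded[OF compact_continuous_image[OF cX compact_SO3]] by (auto simp: bounded_iff)
  have B0: "B \<ge> 0" using B[OF SO3_one] norm_ge_zero order_trans by blast
  have bound: "cmod (?X w * ?t k w) \<le> B * (a k)\<^sup>2" if "w \<in> SO3" for w k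
    unfolding norm_mult[of "?X w"] using B[OF that] B0 a_sq_T_bound[OF SO3_transpose[OF that]] by (intro mult_mono) auto
  have int: "integrable haar (\<lambda>w. ?X w * ?t k w)" for k
    by (intro haar_integrable continuous_intros cX continuous_on_T_transpose)
  \<comment> \<open>Sum and integral may be exchanged because the terms are dominated by the
    summable \<open>B * (a k)\<^sup>2\<close>.\<close>
  have "(\<integral>w. (\<Sum>k. ?X w * ?t k w) \<partial>haar) = (\<Sum>k. \<integral>w. ?X w * ?t k w \<partial>haar)"
  proof (rule integral_suminf[OF int])
    show "AE w in haar. summable (\<lambda>k. norm (?X w * ?t k w))"
    proof (rule AE_I2)
      fix w assume "w \<in> space haar"
      then show "summable (\<lambda>k. norm (?X w * ?t k w))"
        using bound by (intro summable_comparison_test'[OF summable_mult[OF summable_a_sq]]) (auto simp: space_haar)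
    qed
    show "summable (\<lambda>k. \<integral>w. norm (?X w * ?t k w) \<partial>haar)"
    proof (rule summable_comparison_test'[OF summable_mult[OF summable_a_sq, of B]])
      fix k
      have "(\<integral>w. norm (?X w * ?t k w) \<partial>haar) \<le> (\<integral>w. B * (a k)\<^sup>2 \<partial>haar)"
        using int[of k] bound by (intro integral_mono integrable_norm) (auto simp: space_haar)
      then show "norm (\<integral>w. norm (?X w * ?t k w) \<partial>haar) \<le> B * (a k)\<^sup>2"
        by (simp add: haar.prob_space)
    qed
  qed
  also have "\<dots> = (\<Sum>k. if k = l then coef l else 0)" by (intro suminf_cong) (simp only: t_int, simp)
  also have "\<dots> = coef l" by (rule sums_unique[symmetric, OF sums_single])
  finally have 1: "(\<integral>w. (\<Sum>k. ?X w * ?t k w) \<partial>haar) = coef l" .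
  have "(\<integral>w. ?X w * K (transpose w) \<partial>haar) = (\<Sum>m\<in>degs l. \<integral>w. T l w m m * K (transpose w) \<partial>haar)"
    using integrable_T_K by (simp add: rep_char_def sum_distrib_right)
  also have "\<dots> = (\<Sum>m\<in>degs l. if m = j then coef l else 0)"
    using integral_T_K_eq_0 by (intro sum.cong refl) (auto simp: coef_def)
  also have "\<dots> = coef l" using coef_eq_0[of l] by auto
  finally have 2: "(\<integral>w. ?X w * K (transpose w) \<partial>haar) = coef l" .
  have pull: "(\<Sum>k. ?X w * ?t k w) = ?X w * (\<Sum>k. ?t k w)" if w: "w \<in> SO3" for w
    by (rule suminf_mult[OF summable_norm_cancel[OF summable_comparison_test'[OF summable_a_sq]]])
       (use a_sq_T_bound[OF SO3_transpose[OF w]] in auto)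
  have "(\<integral>w. ?X w * residual w \<partial>haar) = (\<integral>w. ?X w * K (transpose w) - ?X w * (K (transpose w) - residual w) \<partial>haar)"
    by (rule haar_integral_cong) (simp add: algebra_simps)
  also have "\<dots> = (\<integral>w. ?X w * K (transpose w) \<partial>haar) - (\<integral>w. ?X w * (K (transpose w) - residual w) \<partial>haar)"
    by (intro Bochner_Integration.integral_diff haar_integrable continuous_intros cX continuous_on_K_transpose continuous_on_residual)
  also have "(\<integral>w. ?X w * (K (transpose w) - residual w) \<partial>haar) = (\<integral>w. (\<Sum>k. ?X w * ?t k w) \<partial>haar)"
    by (rule haar_integral_cong) (simp add: residual_def pull del: of_real_power)
  finally show ?thesis by (simp only: 1 2) simp
qed

text \<open>Parseval's identity, read off from the vanishing of the residual at the
  identity.\<close>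

lemma sums_a_sq: "(\<lambda>l. (a l)\<^sup>2) sums (L2_norm M (Y (mat 1)))\<^sup>2"
proof -
  have "residual (mat 1) = 0"
    by (rule vanishing_at_one_if_char_orthogonal[OF T continuous_on_residual residual_orthogonal_char])
  moreover have "of_real ((a l)\<^sup>2) * T l (mat 1) j j = of_real ((a l)\<^sup>2)" for l
    using canonical_rep_one[OF T, of j l j] a_zero_outside[of l] by (cases "j \<in> degs l") auto
  ultimately have "complex_of_real ((L2_norm M (Y (mat 1)))\<^sup>2) = (\<Sum>l. complex_of_real ((a l)\<^sup>2))"
    by (simp add: residual_def K_one_nonneg del: of_real_power)
  also have "\<dots> = complex_of_real (\<Sum>l. (a l)\<^sup>2)"
    by (rule suminf_of_real[symmetric, OF summable_a_sq])
  finally have "(L2_norm M (Y (mat 1)))\<^sup>2 = (\<Sum>l. (a l)\<^sup>2)" by (simp only: of_real_eq_iff)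
  with summable_sums[OF summable_a_sq] show ?thesis by simp
qed

lemma sq_dist_partial_sum_tendsto:
  assumes g: "g \<in> SO3"
  shows "(\<lambda>L. L2_sq_dist M (\<lambda>\<omega>. \<Sum>l<L. f g l \<omega>) (Y g)) \<longlonglongrightarrow> 0"
  unfolding sq_dist_partial_sum[OF g]
  using tendsto_diff[OF tendsto_const sums_a_sq[unfolded sums_def], of "(L2_norm M (Y (mat 1)))\<^sup>2"] by simp

lemma L2_sums_Y:
  assumes g: "g \<in> SO3"
  shows "L2_sums M (f g) (Y g)"
  using sq_dist_partial_sum_tendsto[OF g] f_L2 Y_L2[OF g] by (simp add: L2_sums_def)

lemma covariance_sums:
  assumes g: "g \<in> SO3" and h: "h \<in> SO3"
  shows "(\<lambda>l. of_real ((a l)\<^sup>2) * T l (transpose g ** h) j j) sums L2_inner M (Y g) (Y h)"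
proof -
  have "(\<lambda>L. L2_inner M (\<lambda>\<omega>. \<Sum>l<L. f g l \<omega>) (Y h)) \<longlonglongrightarrow> L2_inner M (Y g) (Y h)"
    by (rule L2_inner_tendsto_left[OF _ Y_L2[OF g] Y_L2[OF h] sq_dist_partial_sum_tendsto[OF g]])
       (intro always_eventually allI L2_space_sum f_L2)
  moreover have "L2_inner M (\<lambda>\<omega>. \<Sum>l<L. f g l \<omega>) (Y h) = (\<Sum>l<L. of_real ((a l)\<^sup>2) * T l (transpose g ** h) j j)" for L
    by (subst L2_inner_sum_left) (simp_all add: f_L2 Y_L2[OF h] inner_f_Y[OF g h])
  ultimately show ?thesis by (simp add: sums_def)
qed

end

section \<open>Completing the orthonormal family on the enlarged space\<close>

abbreviation unit_interval_measure :: "real measure" where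
  "unit_interval_measure \<equiv> uniform_measure lborel {0..1}"

lemma prob_space_unit_interval: "prob_space unit_interval_measure"
  by (rule prob_space_uniform_measure) auto

lemma distr_enlarged_fst: "distr (enlarged M) M fst = M"
  unfolding enlarged_def by (rule prob_space.distr_pair_fst[OF prob_space_unit_interval])

lemma integral_enlarged_fst:
  fixes h :: "'w \<Rightarrow> 'b::{banach, second_countable_topology}"
  assumes "h \<in> borel_measurable M"
  shows "(\<integral>\<omega>. h (fst \<omega>) \<partial>enlarged M) = (\<integral>\<omega>. h \<omega> \<partial>M)"
  using integral_distr[OF _ assms, of fst "enlarged M"] distr_enlarged_fst[of M]
  by (simp add: enlarged_def)

lemma L2_space_enlarged_fst:
  assumes "X \<in> L2_space M"
  shows "X \<circ> fst \<in> L2_space (enlarged M)"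
proof -
  have fst: "fst \<in> enlarged M \<rightarrow>\<^sub>M M" by (simp add: enlarged_def)
  note X = L2_spaceD[OF assms]
  have "integrable (distr (enlarged M) M fst) (\<lambda>\<omega>. (cmod (X \<omega>))\<^sup>2)"
    using X(2) by (simp add: distr_enlarged_fst)
  then have "integrable (enlarged M) (\<lambda>\<omega>. (cmod (X (fst \<omega>)))\<^sup>2)"
    by (rule integrable_distr[OF fst])
  then show ?thesis
    using measurable_compose[OF fst X(1)] by (simp add: L2_space_def comp_def)
qed

lemma L2_inner_enlarged_fst:
  assumes "X \<in> L2_space M" "Y \<in> L2_space M"
  shows "L2_inner (enlarged M) (X \<circ> fst) (Y \<circ> fst) = L2_inner M X Y"
  unfolding L2_inner_def comp_def
  using L2_mult_integrable[OF assms] by (intro integral_enlarged_fst) auto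

lemma L2_sq_dist_enlarged_fst:
  assumes "X \<in> L2_space M" "Y \<in> L2_space M"
  shows "L2_sq_dist (enlarged M) (X \<circ> fst) (Y \<circ> fst) = L2_sq_dist M X Y"
  unfolding L2_sq_dist_def comp_def
  using L2_spaceD(2)[OF L2_space_diff[OF assms]] by (intro integral_enlarged_fst) auto

lemma L2_sums_enlarged_fst:
  assumes "L2_sums M F Y"
  shows "L2_sums (enlarged M) (\<lambda>l. F l \<circ> fst) (Y \<circ> fst)"
proof -
  have F: "F l \<in> L2_space M" for l using assms by (auto simp: L2_sums_def)
  have Y: "Y \<in> L2_space M" and lim: "(\<lambda>L. L2_sq_dist M (\<lambda>\<omega>. \<Sum>l<L. F l \<omega>) Y) \<longlonglongrightarrow> 0"
    using assms by (auto simp: L2_sums_def)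
  have "L2_sq_dist (enlarged M) (\<lambda>\<omega>. \<Sum>l<L. (F l \<circ> fst) \<omega>) (Y \<circ> fst) = L2_sq_dist M (\<lambda>\<omega>. \<Sum>l<L. F l \<omega>) Y" for L
    using L2_sq_dist_enlarged_fst[OF L2_space_sum[where I = "{..<L}" and F = F, OF F] Y] by (simp add: comp_def)
  then show ?thesis
    using F Y lim by (simp add: L2_sums_def L2_space_enlarged_fst)
qed

text \<open>Frequencies start at one. Leaving out the constant exponential gives every function mean
  zero, which makes it orthogonal to all variables of the original space.\<close>

definition fourier :: "nat \<Rightarrow> real \<Rightarrow> complex" where
  "fourier k x = cis (2 * pi * (real k + 1) * x)"

lemma fourier_measurable: "fourier k \<in> borel_measurable borel"
  unfolding fourier_def[abs_def] cis_conv_exp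
  by (intro borel_measurable_continuous_onI continuous_intros)

lemma integral_cis_unit_interval:
  fixes n :: int
  assumes "n \<noteq> 0"
  shows "(\<integral>x. cis (2 * pi * of_int n * x) \<partial>unit_interval_measure) = 0"
proof -
  define k where "k = \<i> * complex_of_real (2 * pi * of_int n)"
  have k: "k \<noteq> 0" using assms by (simp add: k_def)
  have cis: "cis (2 * pi * of_int n * x) = exp (k * of_real x)" for x
    by (simp add: cis_conv_exp k_def mult_ac)
  have cm: "(\<lambda>x. exp (k * complex_of_real x)) \<in> borel_measurable borel"
    by (intro borel_measurable_continuous_onI continuous_intros)
  have "unit_interval_measure = density lborel (\<lambda>x. ennreal (indicat_real {0..1} x))"
    unfolding uniform_measure_def by (intro arg_cong2[where f = density]) (auto split: split_indicator)
  then have "(\<integral>x. exp (k * complex_of_real x) \<partial>unit_interval_measure)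
      = (\<integral>x. indicat_real {0..1} x *\<^sub>R exp (k * complex_of_real x) \<partial>lborel)"
    using cm by (simp add: integral_density)
  also have "\<dots> = exp (k * of_real 1) / k - exp (k * of_real 0) / k"
  proof (rule integral_FTC_atLeastAtMost)
    show "continuous_on {0..1} (\<lambda>x. exp (k * complex_of_real x))" by (intro continuous_intros)
    show "((\<lambda>x. exp (k * complex_of_real x) / k) has_vector_derivative exp (k * complex_of_real x)) (at x within {0..1})" for x
      using k by (intro has_vector_derivative_real_field) (auto intro!: derivative_eq_intros)
  qed simp
  also have "\<dots> = 0" using cis_multiple_2pi[of "of_int n"] cis[of 1] by simp
  finally show ?thesis by (simp only: cis)
qed

lemma fourier_snd_L2:
  assumes "prob_space M"
  shows "fourier k \<circ> snd \<in> L2_space (enlarged M)"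
proof -
  interpret prob_space "enlarged M" by (rule prob_space_enlarged[OF assms])
  have "snd \<in> enlarged M \<rightarrow>\<^sub>M unit_interval_measure" by (simp add: enlarged_def)
  moreover have "fourier k \<in> borel_measurable unit_interval_measure"
    by (simp add: measurable_cong_sets[OF sets_uniform_measure refl] fourier_measurable)
  ultimately have "(\<lambda>\<omega>. fourier k (snd \<omega>)) \<in> borel_measurable (enlarged M)"
    by (rule measurable_compose)
  then
  show ?thesis by (simp add: L2_space_def comp_def fourier_def)
qed

lemma integral_fourier: "(\<integral>x. fourier k x \<partial>unit_interval_measure) = 0"
  using integral_cis_unit_interval[of "int k + 1"] by (simp add: fourier_def)

lemma L2_inner_enlarged_integral:
  assumes M: "prob_space M" and "X \<in> L2_space (enlarged M)" "Y \<in> L2_space (enlarged M)"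
  shows "L2_inner (enlarged M) X Y = (\<integral>\<omega>. (\<integral>x. X (\<omega>, x) * cnj (Y (\<omega>, x)) \<partial>unit_interval_measure) \<partial>M)"
proof -
  interpret M: prob_space M by fact
  interpret U: prob_space unit_interval_measure by (rule prob_space_unit_interval)
  interpret pair_sigma_finite M unit_interval_measure ..
  show ?thesis
    using integral_fst'[OF L2_mult_integrable[OF assms(2,3), unfolded enlarged_def]]
    by (simp add: L2_inner_def enlarged_def)
qed

lemma L2_inner_fst_fourier:
  assumes M: "prob_space M" and X: "X \<in> L2_space M"
  shows "L2_inner (enlarged M) (X \<circ> fst) (fourier k \<circ> snd) = 0"
  unfolding L2_inner_enlarged_integral[OF M L2_space_enlarged_fst[OF X] fourier_snd_L2[OF M]]
  by (simp add: integral_fourier)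

lemma L2_inner_fourier:
  assumes M: "prob_space M"
  shows "L2_inner (enlarged M) (fourier k \<circ> snd) (fourier k' \<circ> snd) = of_bool (k = k')"
proof -
  interpret M: prob_space M by fact
  interpret U: prob_space unit_interval_measure by (rule prob_space_unit_interval)
  have "fourier k x * cnj (fourier k' x) = cis (2 * pi * of_int (int k - int k') * x)" for x
    by (simp add: fourier_def cis_cnj cis_mult algebra_simps)
  then have "(\<integral>x. fourier k x * cnj (fourier k' x) \<partial>unit_interval_measure) = of_bool (k = k')"
    using integral_cis_unit_interval[of "int k - int k'"] U.prob_space by (cases "k = k'") auto
  then show ?thesis
    unfolding L2_inner_enlarged_integral[OF M fourier_snd_L2[OF M] fourier_snd_L2[OF M]]
    by (simp add: M.prob_space)
qed

context isotropic_process
begin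

text \<open>Where \<open>a l\<close> is zero the variable does not affect the series and only has to
  complete the orthonormal family; the extra coordinate provides it. \<open>nat (m + int l)\<close>
  is injective on the labels of weight \<open>l\<close>, and pairing it with \<open>l\<close> gives
  every label its own frequency.\<close>

definition Z :: "nat \<Rightarrow> int \<Rightarrow> 'w \<times> real \<Rightarrow> complex" where
  "Z l m = (if a l \<noteq> 0 then W l m \<circ> fst else fourier (prod_encode (l, nat (m + int l))) \<circ> snd)"

lemma Z_orthonormal: "L2_orthonormal (enlarged M) Z"
  unfolding L2_orthonormal_def
proof (intro conjI allI ballI)
  show "Z l m \<in> L2_space (enlarged M)" for l m
    using L2_space_enlarged_fst[OF W_L2] fourier_snd_L2[OF prob] by (simp add: Z_def)
  fix l l' m m' assume m: "m \<in> degs l" "m' \<in> degs l'"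
  show "L2_inner (enlarged M) (Z l m) (Z l' m') = of_bool (l = l') * of_bool (m = m')"
  proof (cases "a l = 0"; cases "a l' = 0")
    assume "a l = 0" "a l' = 0"
    moreover have "nat (m + int l) = nat (m' + int l) \<longleftrightarrow> m = m'" if "l = l'"
      using m that by (auto simp: degs_def)
    ultimately show ?thesis by (auto simp: Z_def L2_inner_fourier[OF prob])
  next
    assume "a l = 0" "a l' \<noteq> 0"
    moreover from this have "l \<noteq> l'" by auto
    ultimately show ?thesis
      by (simp add: Z_def L2_inner_fst_fourier[OF prob W_L2] L2_inner_commute[of _ "fourier _ \<circ> snd"])
  next
    assume "a l \<noteq> 0" "a l' = 0"
    moreover from this have "l \<noteq> l'" by auto
    ultimately show ?thesis by (simp add: Z_def L2_inner_fst_fourier[OF prob W_L2])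
  next
    assume "a l \<noteq> 0" "a l' \<noteq> 0"
    then show ?thesis by (simp add: Z_def L2_inner_enlarged_fst W_L2 W_orthonormal[OF m])
  qed
qed

lemma L2_sums_Z:
  assumes g: "g \<in> SO3"
  shows "L2_sums (enlarged M)
    (\<lambda>l \<omega>. \<Sum>m\<in>degs l. of_real (a l) * T l (matrix_inv g) j m * Z l m \<omega>) (Y g \<circ> fst)"
proof -
  have "(\<lambda>l \<omega>. \<Sum>m\<in>degs l. of_real (a l) * T l (matrix_inv g) j m * Z l m \<omega>) = (\<lambda>l. f g l \<circ> fst)"
    by (auto simp: fun_eq_iff f_def Z_def SO3_matrix_inv[OF g] intro!: sum.cong)
  with L2_sums_enlarged_fst[OF L2_sums_Y[OF g]] show ?thesis by simp
qed

text \<open>The second conjunct shows that the enlargement adds no randomness to the series: a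
  variable with nonzero factor lives on the original space.\<close>

lemma expansion:
  "\<exists>(a :: nat \<Rightarrow> complex) Z. L2_orthonormal (enlarged M) Z \<and>
     (\<forall>l. \<forall>m\<in>degs l. a l \<noteq> 0 \<longrightarrow> (\<exists>W\<in>L2_space M. Z l m = W \<circ> fst)) \<and>
     (\<forall>g\<in>SO3. L2_sums (enlarged M)
        (\<lambda>l \<omega>. \<Sum>m\<in>degs l. a l * T l (matrix_inv g) j m * Z l m \<omega>) (Y g \<circ> fst)) \<and>
     (\<forall>g1\<in>SO3. \<forall>g2\<in>SO3.
        (\<lambda>l. complex_of_real ((cmod (a l))\<^sup>2) * T l (matrix_inv g1 ** g2) j j)
          sums L2_inner M (Y g1) (Y g2))"
proof (intro exI[of _ "\<lambda>l. complex_of_real (a l)"] exI[of _ Z] conjI ballI allI impI)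
  show "\<exists>W\<in>L2_space M. Z l m = W \<circ> fst" if "complex_of_real (a l) \<noteq> 0" for l m
    using that W_L2[of l m] by (auto simp: Z_def)
  show "(\<lambda>l. complex_of_real ((cmod (complex_of_real (a l)))\<^sup>2) * T l (matrix_inv g1 ** g2) j j)
      sums L2_inner M (Y g1) (Y g2)" if "g1 \<in> SO3" "g2 \<in> SO3" for g1 g2
    using covariance_sums[OF that] by (simp add: SO3_matrix_inv[OF that(1)])
qed (use Z_orthonormal L2_sums_Z in auto)

end

section \<open>The phase factors of the two processes\<close>

lemma euler_rot_z: "euler 0 \<theta> 0 ** rot_z \<beta> = euler 0 \<theta> \<beta>" "euler 0 \<theta> 0 \<in> SO3"
  by (simp_all add: euler_def rot_z_0 rot_x_SO3)

text \<open>By isotropy \<open>K (u ** rot_z \<beta>)\<close> can be computed from any left translate of the pair, so it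
  suffices to know the phase factor at a single rotation, away from the poles.\<close>

lemma isotropic_processI:
  assumes M: "prob_space M" and T: "\<And>l. canonical_rep l (T l)"
    and iso: "weakly_isotropic M Y" and ms: "ms_continuous M Y"
    and h: "h \<in> SO3"
    and phase: "\<And>\<beta>. AE \<omega> in M. Y (h ** rot_z \<beta>) \<omega> = cis (of_int j * \<beta>) * Y h \<omega>"
  shows "isotropic_process M T Y j"
proof (intro isotropic_process.intro M T iso ms)
  fix u \<beta> assume u: "u \<in> SO3"
  \<comment> \<open>Left translation by \<open>k\<close> takes \<open>u\<close> to \<open>h\<close>,
    the rotation at which the phase is known.\<close>
  define k where "k = h ** transpose u"
  have k: "k \<in> SO3" using h u by (simp add: k_def SO3_mult SO3_transpose)
  have ku: "k ** u = h" by (simp add: k_def SO3_transpose_mult[OF u] flip: matrix_mul_assoc)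
  have Y: "Y g \<in> L2_space M" if "g \<in> SO3" for g using iso that by (simp add: weakly_isotropic_def)
  have hb: "h ** rot_z \<beta> \<in> SO3" by (intro SO3_mult h rot_z_SO3)
  have tr: "L2_inner M (Y (mat 1)) (Y v) = L2_inner M (Y k) (Y (k ** v))" if "v \<in> SO3" for v
    using iso k SO3_one that by (simp add: weakly_isotropic_def) (metis matrix_mul_rid)
  have "L2_inner M (Y (mat 1)) (Y (u ** rot_z \<beta>)) = L2_inner M (Y k) (Y (h ** rot_z \<beta>))"
    using tr[OF SO3_mult[OF u rot_z_SO3]] by (simp add: matrix_mul_assoc ku)
  also have "\<dots> = L2_inner M (Y k) (\<lambda>\<omega>. cis (of_int j * \<beta>) * Y h \<omega>)"
    unfolding L2_inner_def
    using phase[of \<beta>] L2_mult_integrable[OF Y[OF k] Y[OF hb]] L2_mult_integrable[OF Y[OF k] L2_space_cmult[OF Y[OF h]]]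
    by (intro integral_cong_AE) auto
  also have "\<dots> = cis (- (of_int j * \<beta>)) * L2_inner M (Y (mat 1)) (Y u)"
    by (simp add: L2_inner_cmult_right cis_cnj tr[OF u] ku)
  finally show "L2_inner M (Y (mat 1)) (Y (u ** rot_z \<beta>)) = cis (- (of_int j * \<beta>)) * L2_inner M (Y (mat 1)) (Y u)" .
qed

theorem theorem2:
  fixes M :: "'w measure"
    and X :: "real^3 \<Rightarrow> 'w \<Rightarrow> complex^3^3"
    and A B :: "real^3^3 \<Rightarrow> 'w \<Rightarrow> complex"
    and T :: "nat \<Rightarrow> real^3^3 \<Rightarrow> int \<Rightarrow> int \<Rightarrow> complex"
  assumes "prob_space M"
    and "\<And>l. canonical_rep l (T l)"
    and "\<And>t. t \<in> sphere 0 1 \<Longrightarrow> integrable M (X t) \<and> (\<integral>\<omega>. X t \<omega> \<partial>M) = 0"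
    and "tangential_sym_tracefree M X"
    and "represents_A M X A"
    and "represents_B M X B"
    and "weakly_isotropic M A" and "ms_continuous M A"
    and "weakly_isotropic M B" and "ms_continuous M B"
  shows "\<exists>(a :: nat \<Rightarrow> complex) (b :: nat \<Rightarrow> complex)
          (ZA :: nat \<Rightarrow> int \<Rightarrow> 'w \<times> real \<Rightarrow> complex) (ZB :: nat \<Rightarrow> int \<Rightarrow> 'w \<times> real \<Rightarrow> complex).
      L2_orthonormal (enlarged M) ZA \<and>
      L2_orthonormal (enlarged M) ZB \<and>
      (\<forall>l. \<forall>m\<in>degs l. a l \<noteq> 0 \<longrightarrow> (\<exists>W\<in>L2_space M. ZA l m = W \<circ> fst)) \<and>
      (\<forall>l. \<forall>m\<in>degs l. b l \<noteq> 0 \<longrightarrow> (\<exists>W\<in>L2_space M. ZB l m = W \<circ> fst)) \<and>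
      (\<forall>g\<in>SO3. L2_sums (enlarged M)
         (\<lambda>l \<omega>. \<Sum>m\<in>degs l. a l * T l (matrix_inv g) 2 m * ZA l m \<omega>) (A g \<circ> fst)) \<and>
      (\<forall>g\<in>SO3. L2_sums (enlarged M)
         (\<lambda>l \<omega>. \<Sum>m\<in>degs l. b l * T l (matrix_inv g) (-2) m * ZB l m \<omega>) (B g \<circ> fst)) \<and>
      (\<forall>g1\<in>SO3. \<forall>g2\<in>SO3.
         (\<lambda>l. complex_of_real ((cmod (a l))\<^sup>2) * T l (matrix_inv g1 ** g2) 2 2)
           sums L2_inner M (A g1) (A g2)) \<and>
      (\<forall>g1\<in>SO3. \<forall>g2\<in>SO3.
         (\<lambda>l. complex_of_real ((cmod (b l))\<^sup>2) * T l (matrix_inv g1 ** g2) (-2) (-2))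
           sums L2_inner M (B g1) (B g2))"
proof -
  \<comment> \<open>A rotation with its point on the equator, away from the poles, where the field
    does not prescribe the values of \<open>A\<close> and \<open>B\<close>.\<close>
  let ?h = "euler 0 (pi / 2) 0"
  have theta: "0 < pi / 2" "pi / 2 < pi" by simp_all
  \<comment> \<open>Right multiplication by \<open>rot_z \<beta>\<close> changes the last Euler
    angle alone, so both sides involve the field at the same point and differ by the exponential
    only.\<close>
  have "AE \<omega> in M. A (?h ** rot_z \<beta>) \<omega> = cis (of_int 2 * \<beta>) * A ?h \<omega>" for \<beta>
    using assms(5)[unfolded represents_A_def, rule_format, of "pi / 2" "pi / 2" 0 \<beta>]
      assms(5)[unfolded represents_A_def, rule_format, of "pi / 2" "pi / 2" 0 0]
    unfolding euler_rot_z by (simp add: theta, elim AE_mp) (auto simp: cis_conv_exp mult_ac)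
  then have A: "isotropic_process M T A 2"
    by (intro isotropic_processI[OF assms(1,2,7,8) euler_rot_z(2)])
  have "AE \<omega> in M. B (?h ** rot_z \<beta>) \<omega> = cis (of_int (-2) * \<beta>) * B ?h \<omega>" for \<beta>
    using assms(6)[unfolded represents_B_def, rule_format, of "pi / 2" "pi / 2" 0 \<beta>]
      assms(6)[unfolded represents_B_def, rule_format, of "pi / 2" "pi / 2" 0 0]
    unfolding euler_rot_z by (simp add: theta, elim AE_mp) (auto simp: cis_conv_exp mult_ac)
  then have B: "isotropic_process M T B (-2)"
    by (intro isotropic_processI[OF assms(1,2,9,10) euler_rot_z(2)])
  show ?thesis
    using isotropic_process.expansion[OF A] isotropic_process.expansion[OF B] by blast
qed

end
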